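(* Let $N\ge1$, $K\in T(M)$, and let $\hat u_N=\sum_{i=0}^N\varepsilon^i\eta_i$. If the evolution equation $u_t=K(u)$ has a zero curvature representation $(U(u))_t-(V(u))_x+[U(u),V(u)]=0$, where $U$ and $V$ are two matrix differential (sometimes multiplication) operators, then the $N$-th order perturbation equation $\hat\eta_{Nt}=\hat K_N(\hat\eta_N)$, i.e. $\eta_{it}=\frac1{i!}\left.\frac{\partial^iK(\hat u_N)}{\partial\varepsilon^i}\right|_{\varepsilon=0}$, $0\le i\le N$, has the zero curvature representation $$(\hat U_N(\hat\eta_N))_t-(\hat V_N(\hat\eta_N))_x+[\hat U_N(\hat\eta_N),\hat V_N(\hat\eta_N)]=0,$$ where $\hat U_N$ and $\hat V_N$ are the lower-triangular block matrices $$\hat U_N(\hat\eta_N)=\left[\frac1{(i-j)!}\left.\frac{\partial^{i-j}U(\hat u_N)}{\partial\varepsilon^{i-j}}\right|_{\varepsilon=0}\right]_{i,j=0,\dots,N},\qquad \hat V_N(\hat\eta_N)=\left[\frac1{(i-j)!}\left.\frac{\partial^{i-j}V(\hat u_N)}{\partial\varepsilon^{i-j}}\right|_{\varepsilon=0}\right]_{i,j=0,\dots,N},$$ with zero blocks for $i<j$.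
   Context: Setting. $M=M(u)$ is a manifold with variable $u$, a column vector of $q$ functions of the spatial variable $x$ (and possibly others); it is treated as a linear space, so that $u+\varepsilon S$ makes sense. $\hat M_N=\hat M_N(\hat\eta_N)$ is the analogous manifold with variable $\hat\eta_N=(\eta_0^T,\dots,\eta_N^T)^T$, each $\eta_i$ being of the same kind and dimension as $u$. $K\in T(M)$ means that $K$ is a vector field on $M$. All objects are assumed smooth, with as many derivatives as needed. Gateaux derivative: $X'(u)[S(u)]=\left.\frac{\partial}{\partial\varepsilon}X(u+\varepsilon S(u))\right|_{\varepsilon=0}$. $U(u),V(u)$ depend smoothly on $u$ (and possibly on a spectral parameter); $(\cdot)_x$ denotes the total $x$-derivative applied to the coefficients (entrywise on matrices and blocks); $[U,V]=UV-VU$. That $u_t=K(u)$ has the zero curvature representation $(U(u))_t-(V(u))_x+[U(u),V(u)]=0$ means that this identity holds when $u$ evolves by $u_t=K(u)$, i.e. $U'(u)[K(u)]-(V(u))_x+[U(u),V(u)]=0$ for all $u\in M$. Likewise for the perturbation equation: $(\hat U_N)'(\hat\eta_N)[\hat K_N(\hat\eta_N)]-(\hat V_N(\hat\eta_N))_x+[\hat U_N(\hat\eta_N),\hat V_N(\hat\eta_N)]=0$ for all $\hat\eta_N\in\hat M_N$. *)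

theory Defs
  imports "HOL-Analysis.Analysis"
begin

(* The independent variables form the space real^'d; the spatial variable is the coordinate with
   index x :: 'd, the remaining coordinates are the possible other variables.  A column vector of
   functions is a map from an index to scalar functions, so that q-vectors (index type 'q) and
   block vectors with N+1 blocks (index (i, a) with i \<le> N) are treated by the same definitions.
   The scalars 'k are the reals or the complex numbers; everything is smooth in the real sense. *)

section \<open>Smooth functions\<close>

primrec C_k :: "nat \<Rightarrow> ('a::real_normed_vector \<Rightarrow> 'b::real_normed_vector) \<Rightarrow> bool" where
  "C_k 0 f \<longleftrightarrow> continuous_on UNIV f"
| "C_k (Suc n) f \<longleftrightarrow>
     (\<forall>z. f differentiable (at z)) \<and> (\<forall>v. C_k n (\<lambda>z. frechet_derivative f (at z) v))"

definition smooth :: "('a::real_normed_vector \<Rightarrow> 'b::real_normed_vector) \<Rightarrow> bool" where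
  "smooth f \<longleftrightarrow> (\<forall>n. C_k n f)"

section \<open>The manifold of dependent variables\<close>

(* M is a linear space of smooth column vector functions.  Its smooth structure is given by its
   smooth families P with two real parameters, as in convenient calculus: a map is smooth iff it
   sends smooth families to smooth families.  (A smooth map in that sense preserves smooth
   families with any number of parameters; two of them suffice for differentiating along curves.)
   Since P need not consist of all jointly smooth families in M, function spaces with their own
   topology fit in, e.g. Schwartz functions with the smooth maps from R^2 to the Schwartz space.
   The axiom division is Hadamard's lemma, valid in every complete function space; it also makes
   the derivatives of smooth families elements of M.  Linearity of M follows from const_family,
   add, scale and mem.  The space of all smooth functions is an instance, see all_smooth below. *)

locale smooth_function_space =
  fixes M :: "('q::finite \<Rightarrow> real^'d \<Rightarrow> 'k::{real_normed_field,euclidean_space}) set"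
    and P :: "(real \<times> real \<Rightarrow> 'q \<Rightarrow> real^'d \<Rightarrow> 'k) set"
  assumes nonempty: "M \<noteq> {}"
    and mem: "c \<in> P \<Longrightarrow> c p \<in> M"
    and jointly_smooth: "c \<in> P \<Longrightarrow> smooth (\<lambda>(p, z). c p a z)"
    and const_family: "u \<in> M \<Longrightarrow> (\<lambda>p. u) \<in> P"
    and add: "c \<in> P \<Longrightarrow> c' \<in> P \<Longrightarrow> (\<lambda>p a z. c p a z + c' p a z) \<in> P"
    and scale: "smooth f \<Longrightarrow> c \<in> P \<Longrightarrow> (\<lambda>p a z. f p *\<^sub>R c p a z) \<in> P"
    and reparametrize: "smooth g \<Longrightarrow> c \<in> P \<Longrightarrow> (\<lambda>p. c (g p)) \<in> P"
    and division: "c \<in> P \<Longrightarrow> (\<And>t. c (0, t) = (\<lambda>a z. 0)) \<Longrightarrow>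
                     \<exists>c'\<in>P. \<forall>s t. c (s, t) = (\<lambda>a z. s *\<^sub>R c' (s, t) a z)"

definition smooth_vector_field ::
  "(real \<times> real \<Rightarrow> 'q \<Rightarrow> real^'d \<Rightarrow> 'k) set \<Rightarrow>
   (('q \<Rightarrow> real^'d \<Rightarrow> 'k) \<Rightarrow> ('q \<Rightarrow> real^'d \<Rightarrow> 'k)) \<Rightarrow> bool" where
  "smooth_vector_field P K \<longleftrightarrow> (\<forall>c\<in>P. (\<lambda>p. K (c p)) \<in> P)"

definition gateaux ::
  "(('q \<Rightarrow> real^'d \<Rightarrow> 'k) \<Rightarrow> 'i \<Rightarrow> 'i \<Rightarrow> 'd list \<Rightarrow> real^'d \<Rightarrow> 'k::real_normed_vector) \<Rightarrow>
   ('q \<Rightarrow> real^'d \<Rightarrow> 'k) \<Rightarrow> ('q \<Rightarrow> real^'d \<Rightarrow> 'k) \<Rightarrow> 'i \<Rightarrow> 'i \<Rightarrow> 'd list \<Rightarrow> real^'d \<Rightarrow> 'k" where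
  "gateaux X u S = (\<lambda>i j w z.
     vector_derivative (\<lambda>\<epsilon>. X (\<lambda>a y. u a y + \<epsilon> *\<^sub>R S a y) i j w z) (at 0))"

section \<open>Matrix differential operators\<close>

definition partial :: "'d::finite \<Rightarrow> (real^'d \<Rightarrow> 'k::real_normed_vector) \<Rightarrow> real^'d \<Rightarrow> 'k" where
  "partial k f = (\<lambda>z. frechet_derivative f (at z) (axis k 1))"

definition partials :: "'d::finite list \<Rightarrow> (real^'d \<Rightarrow> 'k::real_normed_vector) \<Rightarrow> real^'d \<Rightarrow> 'k" where
  "partials w = foldr partial w"

(* A matrix differential operator of order at most m with rows and columns indexed by I is given
   by its coefficient functions A i j w, where the words w of length at most m stand for the
   iterated partial derivatives; order 0 gives the multiplication operators.  Permuted words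
   denote the same derivative of a smooth function, so the coefficients are not unique; hence
   identities between operators are always stated for their action. *)

definition diff_op ::
  "nat \<Rightarrow> 'i set \<Rightarrow> ('i \<Rightarrow> 'i \<Rightarrow> 'd::finite list \<Rightarrow> real^'d \<Rightarrow> 'k::real_normed_field) \<Rightarrow>
   ('i \<Rightarrow> real^'d \<Rightarrow> 'k) \<Rightarrow> 'i \<Rightarrow> real^'d \<Rightarrow> 'k" where
  "diff_op m I A \<phi> = (\<lambda>i z. \<Sum>j\<in>I. \<Sum>w | length w \<le> m. A i j w z * partials w (\<phi> j) z)"

definition smooth_operator ::
  "(real \<times> real \<Rightarrow> 'q \<Rightarrow> real^'d::finite \<Rightarrow> 'k::real_normed_field) set \<Rightarrow> nat \<Rightarrow>
   (('q \<Rightarrow> real^'d \<Rightarrow> 'k) \<Rightarrow> 'r \<Rightarrow> 'r \<Rightarrow> 'd list \<Rightarrow> real^'d \<Rightarrow> 'k) \<Rightarrow> bool" where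
  "smooth_operator P m U \<longleftrightarrow>
     (\<forall>c\<in>P. \<forall>i j w. length w \<le> m \<longrightarrow> smooth (\<lambda>(p, z). U (c p) i j w z))"

(* The operator identity U'(u)[K(u)] - (V(u))_x + [U(u), V(u)] = 0 for all u in M, where U(u) and
   V(u) have orders at most m and n.  A spectral parameter has a fixed value and is suppressed. *)

definition zero_curvature_representation ::
  "'d::finite \<Rightarrow> ('q \<Rightarrow> real^'d \<Rightarrow> 'k::real_normed_field) set \<Rightarrow>
   (('q \<Rightarrow> real^'d \<Rightarrow> 'k) \<Rightarrow> ('q \<Rightarrow> real^'d \<Rightarrow> 'k)) \<Rightarrow> 'i set \<Rightarrow>
   nat \<Rightarrow> (('q \<Rightarrow> real^'d \<Rightarrow> 'k) \<Rightarrow> 'i \<Rightarrow> 'i \<Rightarrow> 'd list \<Rightarrow> real^'d \<Rightarrow> 'k) \<Rightarrow>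
   nat \<Rightarrow> (('q \<Rightarrow> real^'d \<Rightarrow> 'k) \<Rightarrow> 'i \<Rightarrow> 'i \<Rightarrow> 'd list \<Rightarrow> real^'d \<Rightarrow> 'k) \<Rightarrow> bool" where
  "zero_curvature_representation x M K I m U n V \<longleftrightarrow>
     (\<forall>u\<in>M. \<forall>\<phi>. (\<forall>i\<in>I. smooth (\<phi> i)) \<longrightarrow> (\<forall>i\<in>I. \<forall>z.
        diff_op m I (gateaux U u (K u)) \<phi> i z
        - diff_op n I (\<lambda>i j w. partial x (V u i j w)) \<phi> i z
        + (diff_op m I (U u) (diff_op n I (V u) \<phi>) i z
           - diff_op n I (V u) (diff_op m I (U u) \<phi>) i z) = 0))"

section \<open>The perturbation equation\<close>

definition nth_vector_derivative :: "nat \<Rightarrow> (real \<Rightarrow> 'k::real_normed_vector) \<Rightarrow> real \<Rightarrow> 'k" where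
  "nth_vector_derivative n = (\<lambda>f t. vector_derivative f (at t)) ^^ n"

(* The perturbation variable \<eta> has the blocks \<eta>_i = (\<lambda>a. \<eta> (i, a)); only those with i \<le> N matter. *)

definition perturbation_space ::
  "nat \<Rightarrow> ('q \<Rightarrow> real^'d \<Rightarrow> 'k) set \<Rightarrow> (nat \<times> 'q \<Rightarrow> real^'d \<Rightarrow> 'k) set" where
  "perturbation_space N M = {\<eta>. \<forall>i\<le>N. (\<lambda>a. \<eta> (i, a)) \<in> M}"

definition u_hat ::
  "nat \<Rightarrow> (nat \<times> 'q \<Rightarrow> real^'d \<Rightarrow> 'k::real_normed_vector) \<Rightarrow> real \<Rightarrow> 'q \<Rightarrow> real^'d \<Rightarrow> 'k" where
  "u_hat N \<eta> \<epsilon> = (\<lambda>a z. \<Sum>i\<le>N. \<epsilon> ^ i *\<^sub>R \<eta> (i, a) z)"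

definition K_hat ::
  "nat \<Rightarrow> (('q \<Rightarrow> real^'d \<Rightarrow> 'k) \<Rightarrow> ('q \<Rightarrow> real^'d \<Rightarrow> 'k)) \<Rightarrow>
   (nat \<times> 'q \<Rightarrow> real^'d \<Rightarrow> 'k::real_normed_vector) \<Rightarrow> nat \<times> 'q \<Rightarrow> real^'d \<Rightarrow> 'k" where
  "K_hat N K \<eta> = (\<lambda>(i, a) z.
     (1 / fact i) *\<^sub>R nth_vector_derivative i (\<lambda>\<epsilon>. K (u_hat N \<eta> \<epsilon>) a z) 0)"

definition block_hat ::
  "nat \<Rightarrow> (('q \<Rightarrow> real^'d \<Rightarrow> 'k) \<Rightarrow> 'r \<Rightarrow> 'r \<Rightarrow> 'd list \<Rightarrow> real^'d \<Rightarrow> 'k) \<Rightarrow>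
   (nat \<times> 'q \<Rightarrow> real^'d \<Rightarrow> 'k::real_normed_vector) \<Rightarrow>
   nat \<times> 'r \<Rightarrow> nat \<times> 'r \<Rightarrow> 'd list \<Rightarrow> real^'d \<Rightarrow> 'k" where
  "block_hat N U \<eta> = (\<lambda>(i, a) (j, b) w z.
     if j \<le> i
     then (1 / fact (i - j)) *\<^sub>R
            nth_vector_derivative (i - j) (\<lambda>\<epsilon>. U (u_hat N \<eta> \<epsilon>) a b w z) 0
     else 0)"

section \<open>The space of all smooth functions\<close>

lemma C_k_SucI:
  assumes "\<And>z. (f has_derivative f' z) (at z)" "\<And>v. C_k n (\<lambda>z. f' z v)"
  shows "C_k (Suc n) f"
proof -
  have "frechet_derivative f (at z) = f' z" for z
    using assms(1) frechet_derivative_at by metis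
  then show ?thesis using assms by (auto simp: differentiable_def)
qed

lemma C_k_SucD:
  assumes "C_k (Suc n) f"
  shows "(f has_derivative frechet_derivative f (at z)) (at z)"
    and "C_k n (\<lambda>z. frechet_derivative f (at z) v)"
  using assms frechet_derivative_works by auto

lemma C_k_antimono_Suc: "C_k (Suc n) f \<Longrightarrow> C_k n f"
proof (induction n arbitrary: f)
  case 0
  then show ?case
    by (auto simp: continuous_on_eq_continuous_within intro: differentiable_imp_continuous_within)
next
  case (Suc n)
  have "C_k n (\<lambda>z. frechet_derivative f (at z) v)" for v
    using Suc.IH[OF C_k_SucD(2)[OF Suc.prems]] .
  then show ?case using Suc.prems by simp
qed

lemma C_k_const: "C_k n (\<lambda>z. c)"
proof (induction n arbitrary: c)
  case (Suc n)
  show ?case by (rule C_k_SucI[where f'="\<lambda>z v. 0"]) (auto simp: Suc)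
qed simp

lemma C_k_linear: "bounded_linear g \<Longrightarrow> C_k n g"
proof (cases n)
  case (Suc m)
  assume "bounded_linear g"
  then show ?thesis unfolding Suc
    by (intro C_k_SucI[where f'="\<lambda>z. g"]) (auto simp: C_k_const bounded_linear_imp_has_derivative)
qed (simp add: linear_continuous_on)

lemma C_k_bounded_linear: "bounded_linear g \<Longrightarrow> C_k n f \<Longrightarrow> C_k n (\<lambda>z. g (f z))"
proof (induction n arbitrary: f)
  case 0
  then show ?case by (auto intro: linear_continuous_on_compose bounded_linear.continuous_on)
next
  case (Suc n)
  show ?case
    by (rule C_k_SucI[OF bounded_linear.has_derivative[OF Suc.prems(1) C_k_SucD(1)[OF Suc.prems(2)]]])
      (rule Suc.IH[OF Suc.prems(1) C_k_SucD(2)[OF Suc.prems(2)]])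
qed

lemma C_k_add: "C_k n f \<Longrightarrow> C_k n g \<Longrightarrow> C_k n (\<lambda>z. f z + g z)"
proof (induction n arbitrary: f g)
  case 0
  then show ?case by (auto intro: continuous_intros)
next
  case (Suc n)
  show ?case
    by (rule C_k_SucI[OF has_derivative_add[OF C_k_SucD(1)[OF Suc.prems(1)] C_k_SucD(1)[OF Suc.prems(2)]]])
      (rule Suc.IH[OF C_k_SucD(2)[OF Suc.prems(1)] C_k_SucD(2)[OF Suc.prems(2)]])
qed

lemma C_k_sum: "(\<And>i. i \<in> I \<Longrightarrow> C_k n (f i)) \<Longrightarrow> C_k n (\<lambda>z. \<Sum>i\<in>I. f i z)"
  by (induction I rule: infinite_finite_induct) (auto simp: C_k_const intro: C_k_add)

lemma C_k_bilinear:
  assumes "bounded_bilinear b"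
  shows "C_k n f \<Longrightarrow> C_k n g \<Longrightarrow> C_k n (\<lambda>z. b (f z) (g z))"
proof (induction n arbitrary: f g)
  case 0
  then show ?case using bounded_bilinear.continuous_on[OF assms] by auto
next
  case (Suc n)
  note f = Suc.prems(1) and g = Suc.prems(2)
  show ?case
    by (rule C_k_SucI[OF bounded_bilinear.FDERIV[OF assms C_k_SucD(1)[OF f] C_k_SucD(1)[OF g]]])
      (intro C_k_add Suc.IH C_k_SucD(2)[OF f] C_k_SucD(2)[OF g] C_k_antimono_Suc[OF f] C_k_antimono_Suc[OF g])
qed

lemma C_k_compose:
  fixes g :: "'a::real_normed_vector \<Rightarrow> 'b::euclidean_space"
  shows "C_k n f \<Longrightarrow> C_k n g \<Longrightarrow> C_k n (\<lambda>z. f (g z))"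
proof (induction n arbitrary: f)
  case 0
  then show ?case using continuous_on_compose2[of UNIV f UNIV g] by auto
next
  case (Suc n)
  note f = Suc.prems(1) and g = Suc.prems(2)
  let ?D = "\<lambda>f z. frechet_derivative f (at z)"
  have lin: "bounded_linear (?D f z)" for z
    using C_k_SucD(1)[OF f] has_derivative_bounded_linear by blast
  have eq: "?D f (g z) (?D g z v) = (\<Sum>b\<in>Basis. (?D g z v \<bullet> b) *\<^sub>R ?D f (g z) b)" for z v
    by (subst euclidean_representation[of "?D g z v", symmetric])
      (simp add: linear_sum[OF bounded_linear.linear[OF lin]] linear_cmul[OF bounded_linear.linear[OF lin]])
  show ?case
  proof (rule C_k_SucI)
    show "((\<lambda>z. f (g z)) has_derivative (\<lambda>v. ?D f (g z) (?D g z v))) (at z)" for z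
      by (rule has_derivative_compose[OF C_k_SucD(1)[OF g] C_k_SucD(1)[OF f]])
    show "C_k n (\<lambda>z. ?D f (g z) (?D g z v))" for v
      unfolding eq
      by (intro C_k_sum C_k_bilinear[OF bounded_bilinear_scaleR]
            C_k_bounded_linear[OF bounded_linear_inner_left]
            C_k_SucD(2)[OF g] Suc.IH[OF C_k_SucD(2)[OF f] C_k_antimono_Suc[OF g]])
  qed
qed

lemma C_k_Pair: "C_k n f \<Longrightarrow> C_k n g \<Longrightarrow> C_k n (\<lambda>z. (f z, g z))"
proof (induction n arbitrary: f g)
  case 0
  then show ?case by (auto intro: continuous_on_Pair)
next
  case (Suc n)
  show ?case
    by (rule C_k_SucI[OF has_derivative_Pair[OF C_k_SucD(1)[OF Suc.prems(1)] C_k_SucD(1)[OF Suc.prems(2)]]])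
      (rule Suc.IH[OF C_k_SucD(2)[OF Suc.prems(1)] C_k_SucD(2)[OF Suc.prems(2)]])
qed

lemma C_k_integral:
  fixes G :: "'a::euclidean_space \<Rightarrow> real \<Rightarrow> 'k::euclidean_space"
  shows "C_k n (\<lambda>(y, r). G y r) \<Longrightarrow> C_k n (\<lambda>y. integral {0..1} (G y))"
proof (induction n arbitrary: G)
  case 0
  have "continuous_on (UNIV \<times> cbox 0 1) (\<lambda>(y, r). G y r)"
    using 0 continuous_on_subset[of UNIV] by auto
  from integral_continuous_on_param[OF this] show ?case by simp
next
  case (Suc n)
  let ?G = "\<lambda>(y, r). G y r"
  let ?D = "\<lambda>y r v. frechet_derivative ?G (at (y, r)) (v, 0)"
  have cont: "continuous_on S ?G" for S
    using Suc.prems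
    by (metis C_k.simps(2) continuous_on_subset differentiable_imp_continuous_on
        differentiable_on_def subset_UNIV)
  have pair: "continuous_on {0..1} (Pair y :: real \<Rightarrow> 'a \<times> real)" for y
    by (rule continuous_on_Pair[OF continuous_on_const continuous_on_id])
  have der: "((\<lambda>y. G y r) has_derivative ?D y r) (at y)" for y r
  proof -
    have "((\<lambda>y. (y, r)) has_derivative (\<lambda>v. (v, 0))) (at y)"
      by (auto intro!: derivative_eq_intros)
    from has_derivative_compose[OF this C_k_SucD(1)[OF Suc.prems]] show ?thesis by simp
  qed
  have bl: "bounded_linear (?D y r)" for y r
    using der has_derivative_bounded_linear by blast
  have contD: "continuous_on S (\<lambda>(y, r). ?D y r v)" for S v
  proof -
    have "C_k m f \<Longrightarrow> C_k 0 f" for m and f :: "'a \<times> real \<Rightarrow> 'k"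
      by (induction m) (auto simp del: C_k.simps intro: C_k_antimono_Suc)
    from this[OF C_k_SucD(2)[OF Suc.prems, of "(v, 0)"]]
    show ?thesis using continuous_on_subset[of UNIV] by (auto simp: case_prod_beta')
  qed
  have contB: "continuous_on S (\<lambda>(y, r). Blinfun (?D y r))" for S
  proof (rule continuous_on_blinfun_componentwise)
    fix i :: 'a
    have "(\<lambda>z. blinfun_apply (case z of (y, r) \<Rightarrow> Blinfun (?D y r)) i) = (\<lambda>(y, r). ?D y r i)"
      by (rule ext, case_tac z) (simp only: prod.case bounded_linear_Blinfun_apply[OF bl])
    then show "continuous_on S (\<lambda>z. blinfun_apply (case z of (y, r) \<Rightarrow> Blinfun (?D y r)) i)"
      by (simp only: contD)
  qed
  have "((\<lambda>y. integral (cbox 0 1) (G y)) has_derivative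
           integral (cbox 0 1) (\<lambda>r. Blinfun (?D y r))) (at y within UNIV)" for y
  proof (rule leibniz_rule)
    show "((\<lambda>y. G y r) has_derivative blinfun_apply (Blinfun (?D y r))) (at y within UNIV)" for y r
      using der bl by (simp add: bounded_linear_Blinfun_apply)
    show "G y integrable_on cbox 0 1" for y
      using continuous_on_compose2[OF cont[of UNIV], of "{0..1}" "\<lambda>r. (y, r)"]
      by (intro integrable_continuous) (auto simp: pair)
    show "continuous_on (UNIV \<times> cbox 0 1) (\<lambda>(y, r). Blinfun (?D y r))"
      by (rule contB)
  qed auto
  moreover have "blinfun_apply (integral (cbox 0 1) (\<lambda>r. Blinfun (?D y r))) v =
      integral {0..1} (\<lambda>r. ?D y r v)" for y v
  proof -
    have "(\<lambda>r. Blinfun (?D y r)) integrable_on cbox 0 1"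
      using continuous_on_compose2[OF contB[of UNIV], of "{0..1}" "\<lambda>r. (y, r)"]
      by (intro integrable_continuous) (auto simp: pair)
    then show ?thesis
      using integral_linear[OF _ blinfun.bounded_linear_left, of "\<lambda>r. Blinfun (?D y r)" "cbox 0 1" v]
      by (simp add: o_def bounded_linear_Blinfun_apply[OF bl])
  qed
  moreover have "C_k n (\<lambda>y. integral {0..1} (\<lambda>r. ?D y r v))" for v
    using C_k_SucD(2)[OF Suc.prems, of "(v, 0)"] by (intro Suc.IH) (simp add: case_prod_beta')
  ultimately show ?case by (intro C_k_SucI) auto
qed

lemma smooth_compose:
  fixes g :: "'a::real_normed_vector \<Rightarrow> 'b::euclidean_space"
  shows "smooth f \<Longrightarrow> smooth g \<Longrightarrow> smooth (\<lambda>z. f (g z))"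
  by (simp add: smooth_def C_k_compose)

lemma smooth_const: "smooth (\<lambda>z. c)"
  by (simp add: smooth_def C_k_const)

lemma smooth_linear: "bounded_linear g \<Longrightarrow> smooth g"
  by (simp add: smooth_def C_k_linear)

lemma smooth_Pair: "smooth f \<Longrightarrow> smooth g \<Longrightarrow> smooth (\<lambda>z. (f z, g z))"
  by (simp add: smooth_def C_k_Pair)

lemma smooth_division:
  fixes f :: "(real \<times> real) \<times> 'a::euclidean_space \<Rightarrow> 'k::euclidean_space"
  assumes f: "smooth f" and zero: "\<And>t z. f ((0, t), z) = 0"
  shows "\<exists>h. smooth h \<and> (\<forall>s t z. f ((s, t), z) = s *\<^sub>R h ((s, t), z))"
proof -
  let ?D = "\<lambda>p. frechet_derivative f (at p) ((1, 0), 0)"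
  define G where "G = (\<lambda>y r. ?D ((r * fst (fst y), snd (fst y)), snd y))"
  define h where "h = (\<lambda>y. integral {0..1} (G y))"
  have "smooth (\<lambda>p. ?D p)" using f C_k_SucD(2) unfolding smooth_def by blast
  moreover have "smooth (\<lambda>y::((real \<times> real) \<times> 'a) \<times> real.
      ((snd y * fst (fst (fst y)), snd (fst (fst y))), snd (fst y)))"
    unfolding smooth_def
    by (intro allI C_k_Pair C_k_bilinear[OF bounded_bilinear_mult] C_k_linear)
      (auto intro!: bounded_linear_intros)
  ultimately have "smooth (\<lambda>(y, r). G y r)"
    unfolding G_def case_prod_beta' by (rule smooth_compose)
  then have "smooth h" unfolding h_def smooth_def using C_k_integral by blast
  moreover have "f ((s, t), z) = s *\<^sub>R h ((s, t), z)" for s t z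
  proof -
    have D: "(f has_derivative frechet_derivative f (at p)) (at p)" for p
      using f C_k_SucD(1) unfolding smooth_def by blast
    have "((\<lambda>r. f ((r * s, t), z)) has_vector_derivative s *\<^sub>R G ((s, t), z) r)
            (at r within {0..1})" for r
    proof -
      have "((\<lambda>r. ((r * s, t), z)) has_derivative (\<lambda>d. ((d * s, 0), 0))) (at r within {0..1})"
        by (auto intro!: derivative_eq_intros)
      from has_derivative_compose[OF this D]
      have "((\<lambda>r. f ((r * s, t), z)) has_derivative
               (\<lambda>d. frechet_derivative f (at ((r * s, t), z)) ((d * s, 0), 0))) (at r within {0..1})" .
      moreover have "frechet_derivative f (at ((r * s, t), z)) ((d * s, 0), 0)
                       = d *\<^sub>R s *\<^sub>R G ((s, t), z) r" for d
        using linear_cmul[OF has_derivative_linear[OF D], of "((r * s, t), z)" "d * s" "((1, 0), 0)"]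
        by (simp add: G_def)
      ultimately show ?thesis by (simp add: has_vector_derivative_def)
    qed
    then have "((\<lambda>r. s *\<^sub>R G ((s, t), z) r) has_integral f ((s, t), z) - f ((0, t), z)) {0..1}"
      using fundamental_theorem_of_calculus[of 0 1 "\<lambda>r. f ((r * s, t), z)"
          "\<lambda>r. s *\<^sub>R G ((s, t), z) r"] by simp
    then show ?thesis using zero
      by (simp add: h_def integral_unique flip: integral_cmul)
  qed
  ultimately show ?thesis by blast
qed

lemma all_smooth:
  "smooth_function_space
     {u :: 'q::finite \<Rightarrow> real^'d \<Rightarrow> 'k::{real_normed_field,euclidean_space}. \<forall>a. smooth (u a)}
     {c. \<forall>a. smooth (\<lambda>(p, z). c p a z)}"
proof
  show "{u :: 'q \<Rightarrow> real^'d \<Rightarrow> 'k. \<forall>a. smooth (u a)} \<noteq> {}"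
    using C_k_const by (auto simp: smooth_def intro!: exI[of _ "\<lambda>a z. 0"])
next
  fix c :: "real \<times> real \<Rightarrow> 'q \<Rightarrow> real^'d \<Rightarrow> 'k" and p :: "real \<times> real"
  assume c: "c \<in> {c. \<forall>a. smooth (\<lambda>(p, z). c p a z)}"
  have "smooth (\<lambda>z::real^'d. (p, z))"
    by (intro smooth_Pair smooth_const smooth_linear bounded_linear_ident)
  moreover have "smooth (\<lambda>(p, z). c p a z)" for a
    using c by blast
  ultimately have "smooth (\<lambda>z. (\<lambda>(p, z). c p a z) (p, z))" for a
    by (rule smooth_compose[rotated])
  then show "c p \<in> {u. \<forall>a. smooth (u a)}" by simp
next
  fix u :: "'q \<Rightarrow> real^'d \<Rightarrow> 'k"
  assume u: "u \<in> {u. \<forall>a. smooth (u a)}"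
  have "smooth (\<lambda>y::(real \<times> real) \<times> (real^'d). u a (snd y))" for a
    by (rule smooth_compose[OF _ smooth_linear[OF bounded_linear_snd]]) (use u in blast)
  then show "(\<lambda>p::real \<times> real. u) \<in> {c. \<forall>a. smooth (\<lambda>(p, z). c p a z)}"
    by (simp add: case_prod_beta')
next
  fix c c' :: "real \<times> real \<Rightarrow> 'q \<Rightarrow> real^'d \<Rightarrow> 'k"
  assume "c \<in> {c. \<forall>a. smooth (\<lambda>(p, z). c p a z)}" "c' \<in> {c. \<forall>a. smooth (\<lambda>(p, z). c p a z)}"
  then show "(\<lambda>p a z. c p a z + c' p a z) \<in> {c. \<forall>a. smooth (\<lambda>(p, z). c p a z)}"
    by (auto simp: case_prod_beta' smooth_def intro!: C_k_add)
next
  fix f :: "real \<times> real \<Rightarrow> real" and c :: "real \<times> real \<Rightarrow> 'q \<Rightarrow> real^'d \<Rightarrow> 'k"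
  assume f: "smooth f" and c: "c \<in> {c. \<forall>a. smooth (\<lambda>(p, z). c p a z)}"
  have "smooth (\<lambda>y::(real \<times> real) \<times> (real^'d). f (fst y))"
    by (rule smooth_compose[OF f smooth_linear[OF bounded_linear_fst]])
  with c show "(\<lambda>p a z. f p *\<^sub>R c p a z) \<in> {c. \<forall>a. smooth (\<lambda>(p, z). c p a z)}"
    by (auto simp: case_prod_beta' smooth_def intro!: C_k_bilinear[OF bounded_bilinear_scaleR])
next
  fix g :: "real \<times> real \<Rightarrow> real \<times> real" and c :: "real \<times> real \<Rightarrow> 'q \<Rightarrow> real^'d \<Rightarrow> 'k"
  assume g: "smooth g" and c: "c \<in> {c. \<forall>a. smooth (\<lambda>(p, z). c p a z)}"
  have "smooth (\<lambda>y::(real \<times> real) \<times> (real^'d). g (fst y))"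
    by (rule smooth_compose[OF g smooth_linear[OF bounded_linear_fst]])
  then have "smooth (\<lambda>y::(real \<times> real) \<times> (real^'d). (g (fst y), snd y))"
    by (rule smooth_Pair[OF _ smooth_linear[OF bounded_linear_snd]])
  moreover have "smooth (\<lambda>(p, z). c p a z)" for a
    using c by blast
  ultimately have "smooth (\<lambda>y. (\<lambda>(p, z). c p a z) (g (fst y), snd y))" for a
    by (rule smooth_compose[rotated])
  then show "(\<lambda>p. c (g p)) \<in> {c. \<forall>a. smooth (\<lambda>(p, z). c p a z)}"
    by (simp add: case_prod_beta')
next
  fix c :: "real \<times> real \<Rightarrow> 'q \<Rightarrow> real^'d \<Rightarrow> 'k"
  assume c: "c \<in> {c. \<forall>a. smooth (\<lambda>(p, z). c p a z)}" and zero: "\<And>t. c (0, t) = (\<lambda>a z. 0)"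
  have "\<exists>h. smooth h \<and> (\<forall>s t z. c (s, t) a z = s *\<^sub>R h ((s, t), z))" for a
    using smooth_division[of "\<lambda>(p, z). c p a z"] c zero by simp
  then obtain h where "\<And>a. smooth (h a)" "\<And>a s t z. c (s, t) a z = s *\<^sub>R h a ((s, t), z)"
    by metis
  then show "\<exists>c'\<in>{c. \<forall>a. smooth (\<lambda>(p, z). c p a z)}. \<forall>s t. c (s, t) = (\<lambda>a z. s *\<^sub>R c' (s, t) a z)"
    by (intro bexI[of _ "\<lambda>p a z. h a (p, z)"]) (auto intro!: ext)
qed auto

end

theory Submission
  imports Defs
begin

text \<open>
  Let \<open>T\<^sub>k\<close> denote the \<open>k\<close>-th Taylor coefficient in \<open>\<epsilon>\<close> at \<open>0\<close>.  Applying a block operator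
  with blocks \<open>T\<^bsub>i-j\<^esub> A(\<epsilon>)\<close> to a block vector \<open>\<phi>\<close> gives \<open>\<Sum>\<^bsub>j\<le>i\<^esub> T\<^bsub>i-j\<^esub> (A(\<epsilon>) \<phi>\<^sub>j)\<close> in row \<open>i\<close>, and by
  the Leibniz rule composition is respected.  So row \<open>i\<close> of the perturbed equation is the sum over
  \<open>j \<le> i\<close> of \<open>T\<^bsub>i-j\<^esub>\<close> of the original equation at \<open>u\<^sub>N(\<epsilon>)\<close> applied to \<open>\<phi>\<^sub>j\<close>.  For the time derivative
  this uses \<open>K(u\<^sub>N(\<epsilon>)) = \<Sum>\<^bsub>i\<le>N\<^esub> \<epsilon>\<^sup>i K\<^sub>i + \<epsilon>\<^bsup>N+1\<^esup> r(\<epsilon>)\<close>, whose remainder does not contribute to \<open>T\<^sub>k\<close>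
  for \<open>k \<le> N\<close> because the Gateaux derivative is linear in its direction.

  Writing \<open>f(\<epsilon>) = f(0) + \<epsilon> g(\<epsilon>)\<close> with smooth \<open>g\<close> turns \<open>T\<^bsub>k+1\<^esub> f\<close> into \<open>T\<^sub>k g\<close>; this recursion replaces
  the symmetry of mixed partial derivatives and the Leibniz rule for higher derivatives.
\<close>

section \<open>Closure properties of smooth maps\<close>

lemma smooth_add: "smooth f \<Longrightarrow> smooth g \<Longrightarrow> smooth (\<lambda>z. f z + g z)"
  by (simp add: smooth_def C_k_add)

lemma smooth_sum: "(\<And>i. i \<in> I \<Longrightarrow> smooth (f i)) \<Longrightarrow> smooth (\<lambda>z. \<Sum>i\<in>I. f i z)"
  by (simp add: smooth_def C_k_sum)

lemma smooth_bilinear: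
  "bounded_bilinear b \<Longrightarrow> smooth f \<Longrightarrow> smooth g \<Longrightarrow> smooth (\<lambda>z. b (f z) (g z))"
  by (simp add: smooth_def C_k_bilinear)

lemmas smooth_scaleR = smooth_bilinear[OF bounded_bilinear_scaleR]
lemmas smooth_mult = smooth_bilinear[OF bounded_bilinear_mult]

lemma smooth_id: "smooth (\<lambda>z. z)"
  by (rule smooth_linear[OF bounded_linear_ident])

lemma smooth_fst: "smooth fst" and smooth_snd: "smooth snd"
  by (simp_all add: smooth_linear bounded_linear_fst bounded_linear_snd)

lemma smooth_uminus: "smooth f \<Longrightarrow> smooth (\<lambda>z. - f z)"
  by (simp add: smooth_def C_k_bounded_linear[OF bounded_linear_minus[OF bounded_linear_ident]])

lemma smooth_diff: "smooth f \<Longrightarrow> smooth g \<Longrightarrow> smooth (\<lambda>z. f z - g z)"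
  using smooth_add[of f "\<lambda>z. - g z"] smooth_uminus by auto

lemma smooth_power: "smooth f \<Longrightarrow> smooth (\<lambda>z. f z ^ i :: real)"
  by (induction i) (simp_all add: smooth_const smooth_mult)

lemma smooth_frechet_derivative: "smooth f \<Longrightarrow> smooth (\<lambda>z. frechet_derivative f (at z) v)"
  unfolding smooth_def using C_k_SucD(2) by blast

lemma smooth_has_derivative:
  "smooth f \<Longrightarrow> (f has_derivative frechet_derivative f (at z)) (at z)"
  unfolding smooth_def using C_k_SucD(1) by blast

lemma smooth_differentiable: "smooth f \<Longrightarrow> f differentiable at z"
  unfolding differentiable_def using smooth_has_derivative by blast

section \<open>Jointly smooth maps and their sections\<close>

lemma smooth_curry:
  fixes F :: "'p::euclidean_space \<Rightarrow> 'a::euclidean_space \<Rightarrow> 'b::real_normed_vector"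
  assumes F: "smooth (\<lambda>(p, z). F p z)" and f: "smooth f" and g: "smooth g"
  shows "smooth (\<lambda>y. F (f y) (g y))"
  using smooth_compose[OF F smooth_Pair[OF f g]] by simp

text \<open>Chain rule along \<open>Pair p\<close>. Expressing the derivative in \<open>z\<close>
  alone through the joint derivative carries joint smoothness over to it.\<close>

lemma frechet_derivative_section:
  fixes F :: "'p::euclidean_space \<Rightarrow> 'a::euclidean_space \<Rightarrow> 'b::real_normed_vector"
  assumes F: "smooth (\<lambda>(p, z). F p z)"
  shows "frechet_derivative (F p) (at z) v = frechet_derivative (\<lambda>(p, z). F p z) (at (p, z)) (0, v)"
proof -
  have "(Pair p has_derivative Pair 0) (at z)"
    by (auto intro!: derivative_eq_intros)
  note has_derivative_compose[OF this smooth_has_derivative[OF F]]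
  from fun_cong[OF frechet_derivative_at[OF this], of v] show ?thesis by simp
qed

lemma smooth_frechet_derivative_section:
  fixes F :: "'p::euclidean_space \<Rightarrow> 'a::euclidean_space \<Rightarrow> 'b::real_normed_vector"
  assumes F: "smooth (\<lambda>(p, z). F p z)"
  shows "smooth (\<lambda>(p, z). frechet_derivative (F p) (at z) v)"
  using smooth_frechet_derivative[OF F, of "(0, v)"]
  by (simp add: frechet_derivative_section[OF F] case_prod_beta')

section \<open>Iterated derivatives of curves\<close>

lemma smooth_vector_derivative:
  "smooth f \<Longrightarrow> smooth (\<lambda>t. vector_derivative f (at t))"
  using smooth_frechet_derivative[of f 1] smooth_differentiable[of f]
  by (simp add: frechet_derivative_eq_vector_derivative)

lemma smooth_has_vector_derivative:
  "smooth f \<Longrightarrow> (f has_vector_derivative vector_derivative f (at t)) (at t)"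
  using smooth_differentiable vector_derivative_works by blast

lemma nth_vector_derivative_0 [simp]: "nth_vector_derivative 0 f = f"
  by (simp add: nth_vector_derivative_def)

lemma nth_vector_derivative_Suc:
  "nth_vector_derivative (Suc n) f = (\<lambda>t. vector_derivative (nth_vector_derivative n f) (at t))"
  by (simp add: nth_vector_derivative_def)

lemma smooth_nth_vector_derivative: "smooth f \<Longrightarrow> smooth (nth_vector_derivative n f)"
  by (induction n) (simp_all add: nth_vector_derivative_Suc smooth_vector_derivative)

lemma nth_vector_derivative_has_vector_derivative:
  "smooth f \<Longrightarrow> (nth_vector_derivative n f has_vector_derivative
     nth_vector_derivative (Suc n) f t) (at t)"
  by (simp add: nth_vector_derivative_Suc smooth_has_vector_derivative smooth_nth_vector_derivative)

lemma nth_vector_derivative_add: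
  assumes "smooth f" "smooth g"
  shows "nth_vector_derivative n (\<lambda>t. f t + g t)
           = (\<lambda>t. nth_vector_derivative n f t + nth_vector_derivative n g t)"
proof (induction n)
  case (Suc n)
  show ?case
    unfolding nth_vector_derivative_Suc[of n "\<lambda>t. f t + g t"] Suc
    by (intro ext vector_derivative_at has_vector_derivative_add
          nth_vector_derivative_has_vector_derivative assms)
qed simp

lemma nth_vector_derivative_linear:
  assumes "bounded_linear l" "smooth f"
  shows "nth_vector_derivative n (\<lambda>t. l (f t)) = (\<lambda>t. l (nth_vector_derivative n f t))"
proof (induction n)
  case (Suc n)
  show ?case
    unfolding nth_vector_derivative_Suc[of n "\<lambda>t. l (f t)"] Suc
    by (intro ext vector_derivative_at bounded_linear.has_vector_derivative[OF assms(1)]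
          nth_vector_derivative_has_vector_derivative assms)
qed simp

lemma nth_vector_derivative_const:
  "nth_vector_derivative (Suc n) (\<lambda>t. c) = (\<lambda>t. 0)"
  by (induction n) (simp_all add: nth_vector_derivative_Suc)

text \<open>Higher derivatives of the factor \<open>t\<close> vanish, so the Leibniz rule has only
  two terms. At \<open>t = 0\<close> the second one survives, and its factor is absorbed by the
  factorials in \<open>taylor_coeff\<close>.\<close>

lemma nth_vector_derivative_times_id:
  assumes "smooth f"
  shows "nth_vector_derivative (Suc n) (\<lambda>t. t *\<^sub>R f t)
           = (\<lambda>t. t *\<^sub>R nth_vector_derivative (Suc n) f t + real (Suc n) *\<^sub>R nth_vector_derivative n f t)"
proof (induction n)
  case 0
  show ?case
    unfolding nth_vector_derivative_Suc[of 0 "\<lambda>t. t *\<^sub>R f t"] nth_vector_derivative_0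
    using nth_vector_derivative_has_vector_derivative[OF assms, of 0]
    by (intro ext vector_derivative_at)
      (auto intro!: derivative_eq_intros simp: has_vector_derivative_id)
next
  case (Suc n)
  show ?case
    unfolding nth_vector_derivative_Suc[of "Suc n" "\<lambda>t. t *\<^sub>R f t"] Suc
    using nth_vector_derivative_has_vector_derivative[OF assms]
    by (intro ext vector_derivative_at)
      (auto intro!: derivative_eq_intros simp: algebra_simps scaleR_2)
qed

section \<open>Taylor coefficients at 0\<close>

definition taylor_coeff :: "nat \<Rightarrow> (real \<Rightarrow> 'k::real_normed_vector) \<Rightarrow> 'k" where
  "taylor_coeff k f = (1 / fact k) *\<^sub>R nth_vector_derivative k f 0"

lemma taylor_coeff_0: "taylor_coeff 0 f = f 0"
  by (simp add: taylor_coeff_def)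

lemma taylor_coeff_const: "taylor_coeff k (\<lambda>s. c) = (if k = 0 then c else 0)"
  by (cases k) (simp_all add: taylor_coeff_def nth_vector_derivative_const)

lemma taylor_coeff_add:
  "smooth f \<Longrightarrow> smooth g \<Longrightarrow> taylor_coeff k (\<lambda>s. f s + g s) = taylor_coeff k f + taylor_coeff k g"
  by (simp add: taylor_coeff_def nth_vector_derivative_add scaleR_add_right)

lemma taylor_coeff_linear:
  "bounded_linear l \<Longrightarrow> smooth f \<Longrightarrow> taylor_coeff k (\<lambda>s. l (f s)) = l (taylor_coeff k f)"
  by (simp add: taylor_coeff_def nth_vector_derivative_linear linear_cmul bounded_linear.linear)

lemma taylor_coeff_diff:
  assumes "smooth f" "smooth g"
  shows "taylor_coeff k (\<lambda>s. f s - g s) = taylor_coeff k f - taylor_coeff k g"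
  using taylor_coeff_add[OF assms(1) smooth_uminus[OF assms(2)]]
    taylor_coeff_linear[OF bounded_linear_minus[OF bounded_linear_ident] assms(2)] by simp

lemma taylor_coeff_sum:
  "(\<And>i. i \<in> I \<Longrightarrow> smooth (f i)) \<Longrightarrow>
     taylor_coeff k (\<lambda>s. \<Sum>i\<in>I. f i s) = (\<Sum>i\<in>I. taylor_coeff k (f i))"
  by (induction I rule: infinite_finite_induct)
    (simp_all add: taylor_coeff_const taylor_coeff_add smooth_sum)

lemma taylor_coeff_times_id:
  "smooth f \<Longrightarrow> taylor_coeff (Suc k) (\<lambda>s. s *\<^sub>R f s) = taylor_coeff k f"
  by (simp only: taylor_coeff_def nth_vector_derivative_times_id scaleR_zero_left add_0 scaleR_scaleR)
    (simp add: divide_simps)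

text \<open>Passing to the quotient \<open>g\<close> lowers the index by one; the later inductions
  on \<open>k\<close> obtain such a \<open>g\<close> from Hadamard's lemma.\<close>

lemma taylor_coeff_Suc:
  assumes "smooth g" "\<And>s. f s = c + s *\<^sub>R g s"
  shows "taylor_coeff (Suc k) f = taylor_coeff k g"
proof -
  have "f = (\<lambda>s. c + s *\<^sub>R g s)" using assms(2) by blast
  then show ?thesis
    by (simp add: taylor_coeff_add taylor_coeff_const taylor_coeff_times_id assms(1)
        smooth_const smooth_scaleR smooth_id)
qed

text \<open>Each factor \<open>s\<close> split off lowers both \<open>k\<close> and \<open>n\<close>
  by one, so \<open>k < n\<close> persists until \<open>k = 0\<close>, where a factor
  \<open>s\<close> still remains and vanishes at 0.\<close>

lemma taylor_coeff_eq_0: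
  "smooth g \<Longrightarrow> k < n \<Longrightarrow> taylor_coeff k (\<lambda>s. s ^ n *\<^sub>R g s) = 0"
proof (induction n arbitrary: k)
  case (Suc n)
  show ?case
  proof (cases k)
    case (Suc l)
    have "taylor_coeff (Suc l) (\<lambda>s. s *\<^sub>R (s ^ n *\<^sub>R g s)) = taylor_coeff l (\<lambda>s. s ^ n *\<^sub>R g s)"
      by (intro taylor_coeff_times_id smooth_scaleR smooth_power smooth_id Suc.prems)
    then show ?thesis using Suc Suc.IH Suc.prems by simp
  qed (simp add: taylor_coeff_0)
qed simp

section \<open>Hadamard quotients, the Leibniz rule and the interchange with derivatives\<close>

lemma Hadamard:
  fixes F :: "real \<Rightarrow> 'a::euclidean_space \<Rightarrow> 'k::euclidean_space"
  assumes "smooth (\<lambda>(s, z). F s z)"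
  obtains G where "smooth (\<lambda>(s, z). G s z)" "\<And>s z. F s z = F 0 z + s *\<^sub>R G s z"
proof -
  \<comment> \<open>\<open>smooth_division\<close> divides by the first of two real parameters; the
    second is a dummy here and is set to 0 in the result.\<close>
  let ?f = "\<lambda>y::(real \<times> real) \<times> 'a. F (fst (fst y)) (snd y) - F 0 (snd y)"
  have "smooth ?f"
    by (intro smooth_diff smooth_curry[OF assms] smooth_const smooth_snd
        smooth_compose[OF smooth_fst smooth_fst])
  from smooth_division[OF this] obtain h :: "(real \<times> real) \<times> 'a \<Rightarrow> 'k"
    where h: "smooth h" and eq: "\<forall>s t z. F s z - F 0 z = s *\<^sub>R h ((s, t), z)"
    by auto
  have "smooth (\<lambda>y::real \<times> 'a. h ((fst y, 0), snd y))"
    by (intro smooth_compose[OF h] smooth_Pair smooth_fst smooth_snd smooth_const)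
  then show thesis using eq
    by (intro that[of "\<lambda>s z. h ((s, 0), z)"]) (auto simp: case_prod_beta' algebra_simps)
qed

lemma Hadamard1:
  fixes f :: "real \<Rightarrow> 'k::euclidean_space"
  assumes "smooth f"
  obtains g where "smooth g" "\<And>s. f s = f 0 + s *\<^sub>R g s"
proof -
  \<comment> \<open>A dummy variable \<open>z\<close> brings \<open>f\<close> into the form that
    \<open>Hadamard\<close> expects; it is frozen at 0 afterwards.\<close>
  have "smooth (\<lambda>(s::real, z::real). f s)"
    unfolding case_prod_beta' by (rule smooth_compose[OF assms smooth_fst])
  from Hadamard[OF this] obtain G :: "real \<Rightarrow> real \<Rightarrow> 'k" where G: "smooth (\<lambda>(s, z). G s z)"
    and eq: "\<And>s z. f s = f 0 + s *\<^sub>R G s z" by metis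
  show thesis
    using smooth_curry[OF G smooth_id smooth_const] eq by (intro that[of "\<lambda>s. G s 0"]) auto
qed

text \<open>Induction on \<open>k\<close> with \<open>f s = f 0 + s *\<^sub>R h s\<close>: the
  constant \<open>f 0\<close> yields the summand \<open>j = 0\<close>, and the other term yields the
  remaining summands, shifted by one.\<close>

lemma taylor_coeff_mult:
  fixes f g :: "real \<Rightarrow> 'k::{real_normed_field,euclidean_space}"
  assumes "smooth f" "smooth g"
  shows "taylor_coeff k (\<lambda>s. f s * g s) = (\<Sum>j\<le>k. taylor_coeff j f * taylor_coeff (k - j) g)"
  using assms(1)
proof (induction k arbitrary: f)
  case 0
  then show ?case by (simp add: taylor_coeff_0)
next
  case (Suc k)
  obtain h where h: "smooth h" and eq: "\<And>s. f s = f 0 + s *\<^sub>R h s"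
    using Hadamard1[OF Suc.prems] by metis
  have "(\<lambda>s. f s * g s) = (\<lambda>s. f 0 * g s + s *\<^sub>R (h s * g s))"
    by (subst eq) (simp add: algebra_simps)
  then have "taylor_coeff (Suc k) (\<lambda>s. f s * g s)
      = f 0 * taylor_coeff (Suc k) g + taylor_coeff k (\<lambda>s. h s * g s)"
    using taylor_coeff_add[of "\<lambda>s. f 0 * g s" "\<lambda>s. s *\<^sub>R (h s * g s)" "Suc k"]
      taylor_coeff_linear[OF bounded_linear_mult_right assms(2), of "Suc k" "f 0"]
      taylor_coeff_times_id[OF smooth_mult[OF h assms(2)]]
    by (simp add: smooth_mult smooth_const smooth_scaleR smooth_id h assms(2))
  also have "\<dots> = (\<Sum>j\<le>Suc k. taylor_coeff j f * taylor_coeff (Suc k - j) g)"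
    unfolding sum.atMost_Suc_shift
    using Suc.IH[OF h] taylor_coeff_Suc[OF h eq] by (simp add: taylor_coeff_0)
  finally show ?case .
qed

lemma smooth_taylor_coeff:
  fixes F :: "real \<Rightarrow> 'a::euclidean_space \<Rightarrow> 'k::euclidean_space"
  assumes "smooth (\<lambda>(s, z). F s z)"
  shows "smooth (\<lambda>z. taylor_coeff k (\<lambda>s. F s z))"
  using assms
proof (induction k arbitrary: F)
  case 0
  show ?case using smooth_curry[OF 0 smooth_const smooth_id] by (simp add: taylor_coeff_0)
next
  case (Suc k)
  obtain G where G: "smooth (\<lambda>(s, z). G s z)" "\<And>s z. F s z = F 0 z + s *\<^sub>R G s z"
    using Hadamard[OF Suc.prems] by metis
  have "taylor_coeff (Suc k) (\<lambda>s. F s z) = taylor_coeff k (\<lambda>s. G s z)" for z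
    using smooth_curry[OF G(1) smooth_id smooth_const] G(2) by (rule taylor_coeff_Suc)
  then show ?case using Suc.IH[OF G(1)] by simp
qed

text \<open>The Hadamard quotient of the derivative of \<open>F\<close> in \<open>z\<close> is the
  derivative of the quotient \<open>G\<close>, so both sides descend to index \<open>k\<close>
  together. The result serves the spatial derivatives as well as the derivative in \<open>t\<close>
  behind the Gateaux derivative.\<close>

lemma frechet_derivative_taylor_coeff:
  fixes F :: "real \<Rightarrow> 'a::euclidean_space \<Rightarrow> 'k::euclidean_space"
  assumes "smooth (\<lambda>(s, z). F s z)"
  shows "frechet_derivative (\<lambda>z. taylor_coeff k (\<lambda>s. F s z)) (at z) v
           = taylor_coeff k (\<lambda>s. frechet_derivative (F s) (at z) v)"
  using assms
proof (induction k arbitrary: F)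
  case 0
  show ?case by (simp add: taylor_coeff_0)
next
  case (Suc k)
  obtain G where G: "smooth (\<lambda>(s, z). G s z)" and eq: "\<And>s z. F s z = F 0 z + s *\<^sub>R G s z"
    using Hadamard[OF Suc.prems] by metis
  have sec: "smooth (H s)" if "smooth (\<lambda>(s, z). H s z)" for H :: "real \<Rightarrow> 'a \<Rightarrow> 'k" and s
    using smooth_curry[OF that smooth_const smooth_id] .
  have "taylor_coeff (Suc k) (\<lambda>s. F s z) = taylor_coeff k (\<lambda>s. G s z)" for z
    using smooth_curry[OF G(1) smooth_id smooth_const] eq by (rule taylor_coeff_Suc)
  moreover have "taylor_coeff (Suc k) (\<lambda>s. frechet_derivative (F s) (at z) v)
      = taylor_coeff k (\<lambda>s. frechet_derivative (G s) (at z) v)"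
  proof (rule taylor_coeff_Suc)
    show "smooth (\<lambda>s. frechet_derivative (G s) (at z) v)"
      using smooth_curry[OF smooth_frechet_derivative_section[OF G] smooth_id smooth_const] .
    have "F s = (\<lambda>z. F 0 z + s *\<^sub>R G s z)" for s
      using eq by blast
    moreover have "((\<lambda>z. F 0 z + s *\<^sub>R G s z) has_derivative
        (\<lambda>v. frechet_derivative (F 0) (at z) v + s *\<^sub>R frechet_derivative (G s) (at z) v)) (at z)" for s
      by (intro has_derivative_add has_derivative_scaleR_right smooth_has_derivative sec G Suc.prems)
    ultimately have "(F s has_derivative
        (\<lambda>v. frechet_derivative (F 0) (at z) v + s *\<^sub>R frechet_derivative (G s) (at z) v)) (at z)" for s
      by metis
    from fun_cong[OF frechet_derivative_at[OF this]]
    show "frechet_derivative (F s) (at z) v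
        = frechet_derivative (F 0) (at z) v + s *\<^sub>R frechet_derivative (G s) (at z) v" for s
      by simp
  qed
  ultimately show ?case using Suc.IH[OF G] by simp
qed


lemma taylor_coeff_power:
  "taylor_coeff k (\<lambda>s. s ^ j *\<^sub>R c) = (if k = j then c else 0)"
proof (induction j arbitrary: k)
  case (Suc j)
  show ?case
  proof (cases k)
    case (Suc l)
    have "taylor_coeff (Suc l) (\<lambda>s. s *\<^sub>R (s ^ j *\<^sub>R c)) = taylor_coeff l (\<lambda>s. s ^ j *\<^sub>R c)"
      by (intro taylor_coeff_times_id smooth_scaleR smooth_power smooth_id smooth_const)
    then show ?thesis using Suc Suc.IH by simp
  qed (simp add: taylor_coeff_0)
qed (simp add: taylor_coeff_const)

section \<open>Partial derivatives and differential operators with Taylor coefficient blocks\<close>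

lemma partials_Nil [simp]: "partials [] f = f"
  and partials_Cons [simp]: "partials (k # w) f = partial k (partials w f)"
  by (simp_all add: partials_def)

lemma smooth_partials: "smooth f \<Longrightarrow> smooth (partials w f)"
  by (induction w) (simp_all add: partial_def smooth_frechet_derivative)

lemma smooth_partials_section:
  fixes F :: "'p::euclidean_space \<Rightarrow> real^'d::finite \<Rightarrow> 'b::real_normed_vector"
  assumes "smooth (\<lambda>(p, z). F p z)"
  shows "smooth (\<lambda>(p, z). partials w (F p) z)"
proof (induction w)
  case (Cons k w)
  show ?case using smooth_frechet_derivative_section[OF Cons] by (simp add: partial_def)
qed (simp add: assms)

lemma partials_sum:
  "(\<And>l. l \<in> L \<Longrightarrow> smooth (f l)) \<Longrightarrow> partials w (\<lambda>z. \<Sum>l\<in>L. f l z) = (\<lambda>z. \<Sum>l\<in>L. partials w (f l) z)"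
proof (induction w)
  case (Cons k w)
  have "((\<lambda>z. \<Sum>l\<in>L. partials w (f l) z) has_derivative
      (\<lambda>v. \<Sum>l\<in>L. frechet_derivative (partials w (f l)) (at z) v)) (at z)" for z
    by (intro has_derivative_sum smooth_has_derivative smooth_partials Cons.prems)
  from frechet_derivative_at[OF this] show ?case
    by (simp add: Cons partial_def fun_eq_iff)
qed simp

lemma partials_taylor_coeff:
  fixes F :: "real \<Rightarrow> real^'d::finite \<Rightarrow> 'k::euclidean_space"
  assumes "smooth (\<lambda>(s, z). F s z)"
  shows "partials w (\<lambda>z. taylor_coeff k (\<lambda>s. F s z)) = (\<lambda>z. taylor_coeff k (\<lambda>s. partials w (F s) z))"
proof (induction w)
  case (Cons i w)
  show ?case
    using frechet_derivative_taylor_coeff[OF smooth_partials_section[OF assms]]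
    by (simp add: Cons partial_def)
qed simp

text \<open>Agreement at the point \<open>z\<close> suffices, because the derivatives act on
  \<open>\<phi>\<close> and never on the coefficients.\<close>

lemma diff_op_cong:
  "(\<And>j w. j \<in> I \<Longrightarrow> length w \<le> m \<Longrightarrow> A i j w z = B i j w z) \<Longrightarrow>
     diff_op m I A \<phi> i z = diff_op m I B \<phi> i z"
  unfolding diff_op_def by (intro sum.cong) auto

lemma smooth_diff_op_section:
  fixes A :: "'p::euclidean_space \<Rightarrow> 'i \<Rightarrow> 'i \<Rightarrow> 'd::finite list \<Rightarrow> real^'d \<Rightarrow> 'k::{real_normed_field,euclidean_space}"
  assumes "\<And>j w. j \<in> I \<Longrightarrow> length w \<le> m \<Longrightarrow> smooth (\<lambda>(p, z). A p i j w z)"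
    and "\<And>j. j \<in> I \<Longrightarrow> smooth (\<lambda>(p, z). \<phi> p j z)"
  shows "smooth (\<lambda>(p, z). diff_op m I (A p) (\<phi> p) i z)"
  using assms(1) smooth_partials_section[OF assms(2)] unfolding diff_op_def case_prod_beta'
  by (intro smooth_sum smooth_mult) auto

text \<open>The lower-triangular block Toeplitz matrix of a curve of operators. Unlike
  \<open>block_hat\<close> it takes any curve \<open>A\<close>, so it also covers the Gateaux
  derivative of \<open>U\<close> and the \<open>x\<close>-derivative of \<open>V\<close> along
  \<open>u_hat\<close>.\<close>

definition taylor_block ::
  "(real \<Rightarrow> 'r \<Rightarrow> 'r \<Rightarrow> 'd list \<Rightarrow> real^'d \<Rightarrow> 'k::real_normed_vector) \<Rightarrow>
     nat \<times> 'r \<Rightarrow> nat \<times> 'r \<Rightarrow> 'd list \<Rightarrow> real^'d \<Rightarrow> 'k" where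
  "taylor_block A = (\<lambda>(i, a) (j, b) w z.
     if j \<le> i then taylor_coeff (i - j) (\<lambda>s. A s a b w z) else 0)"

text \<open>The index \<open>q = i - l\<close> counts down from \<open>i\<close>, so that for fixed
  \<open>j\<close> the inner sum can be read as a Cauchy product.\<close>

lemma sum_triangle_reindex:
  fixes i :: nat
  shows "(\<Sum>l\<le>i. \<Sum>j\<le>l. h l j) = (\<Sum>j\<le>i. \<Sum>q\<le>i - j. h (i - q) j)"
  unfolding sum.Sigma[OF finite_atMost ballI[OF finite_atMost]]
  by (rule sum.reindex_bij_witness[of _ "\<lambda>(j, q). (i - q, j)" "\<lambda>(l, j). (j, i - l)"]) auto

text \<open>Row \<open>i\<close> is a Cauchy product in \<open>s\<close>. The input
  \<open>\<psi>\<close> may itself be assembled from curves \<open>\<Psi> j\<close>, and the output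
  has the same shape with the curves \<open>diff_op m UNIV (A s) (\<Psi> j s)\<close>; hence the
  lemma can be iterated for compositions.\<close>

lemma diff_op_taylor_block:
  fixes A :: "real \<Rightarrow> 'r::finite \<Rightarrow> 'r \<Rightarrow> 'd::finite list \<Rightarrow> real^'d \<Rightarrow> 'k::{real_normed_field,euclidean_space}"
  assumes A: "\<And>a b w. length w \<le> m \<Longrightarrow> smooth (\<lambda>(s, z). A s a b w z)"
    and \<Psi>: "\<And>j b. j \<le> N \<Longrightarrow> smooth (\<lambda>(s, z). \<Psi> j s b z)"
    and \<psi>: "\<And>l b z. l \<le> N \<Longrightarrow> \<psi> (l, b) z = (\<Sum>j\<le>l. taylor_coeff (l - j) (\<lambda>s. \<Psi> j s b z))"
    and i: "i \<le> N"
  shows "diff_op m ({..N} \<times> UNIV) (taylor_block A) \<psi> (i, a) z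
           = (\<Sum>j\<le>i. taylor_coeff (i - j) (\<lambda>s. diff_op m UNIV (A s) (\<Psi> j s) a z))"
proof -
  let ?W = "{w :: 'd list. length w \<le> m}"
  let ?A = "\<lambda>b w q. taylor_coeff q (\<lambda>s. A s a b w z)"
  let ?P = "\<lambda>b w j q. taylor_coeff q (\<lambda>s. partials w (\<Psi> j s b) z)"
  have sA: "smooth (\<lambda>s. A s a b w z)" if "length w \<le> m" for b w
    using smooth_curry[OF A[OF that] smooth_id smooth_const] .
  have sP: "smooth (\<lambda>s. partials w (\<Psi> j s b) z)" if "j \<le> N" for w b j
    using smooth_curry[OF smooth_partials_section[OF \<Psi>[OF that]] smooth_id smooth_const] .
  have P: "partials w (\<psi> (l, b)) z = (\<Sum>j\<le>l. ?P b w j (l - j))" if "l \<le> N" for w l b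
  proof -
    have "\<psi> (l, b) = (\<lambda>z. \<Sum>j\<le>l. taylor_coeff (l - j) (\<lambda>s. \<Psi> j s b z))"
      using \<psi> that by blast
    moreover have "partials w (\<lambda>z. \<Sum>j\<le>l. taylor_coeff (l - j) (\<lambda>s. \<Psi> j s b z))
        = (\<lambda>z. \<Sum>j\<le>l. partials w (\<lambda>z. taylor_coeff (l - j) (\<lambda>s. \<Psi> j s b z)) z)"
      using that by (intro partials_sum smooth_taylor_coeff \<Psi>) simp
    ultimately show ?thesis
      using that by (auto intro!: sum.cong simp: partials_taylor_coeff[OF \<Psi>])
  qed
  have "diff_op m ({..N} \<times> UNIV) (taylor_block A) \<psi> (i, a) z
      = (\<Sum>l\<le>N. \<Sum>b\<in>UNIV. \<Sum>w\<in>?W. (if l \<le> i then ?A b w (i - l) else 0) * partials w (\<psi> (l, b)) z)"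
    by (simp add: diff_op_def taylor_block_def sum.cartesian_product')
  \<comment> \<open>Blocks with \<open>l > i\<close> are zero, which cuts the sum off at
    \<open>l = i\<close>.\<close>
  also have "\<dots> = (\<Sum>l\<le>i. \<Sum>b\<in>UNIV. \<Sum>w\<in>?W. ?A b w (i - l) * partials w (\<psi> (l, b)) z)"
    by (rule sum.mono_neutral_cong_right) (use i in auto)
  also have "\<dots> = (\<Sum>l\<le>i. \<Sum>b\<in>UNIV. \<Sum>w\<in>?W. \<Sum>j\<le>l. ?A b w (i - l) * ?P b w j (l - j))"
    using i by (intro sum.cong refl) (simp add: P sum_distrib_left)
  also have "\<dots> = (\<Sum>b\<in>UNIV. \<Sum>w\<in>?W. \<Sum>l\<le>i. \<Sum>j\<le>l. ?A b w (i - l) * ?P b w j (l - j))"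
    by (subst sum.swap, subst sum.swap[of _ ?W]) (rule refl)
  \<comment> \<open>With \<open>q = i - l\<close> the second index \<open>l - j\<close> becomes
    \<open>i - j - q\<close>, as in \<open>taylor_coeff_mult\<close>.\<close>
  also have "\<dots> = (\<Sum>b\<in>UNIV. \<Sum>w\<in>?W. \<Sum>j\<le>i. \<Sum>q\<le>i - j. ?A b w q * ?P b w j (i - j - q))"
    unfolding sum_triangle_reindex by (intro sum.cong refl) (simp add: add.commute)
  also have "\<dots> = (\<Sum>b\<in>UNIV. \<Sum>w\<in>?W. \<Sum>j\<le>i.
      taylor_coeff (i - j) (\<lambda>s. A s a b w z * partials w (\<Psi> j s b) z))"
    using i by (intro sum.cong refl) (simp add: taylor_coeff_mult sA sP)
  also have "\<dots> = (\<Sum>j\<le>i. \<Sum>b\<in>UNIV. \<Sum>w\<in>?W.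
      taylor_coeff (i - j) (\<lambda>s. A s a b w z * partials w (\<Psi> j s b) z))"
    by (subst sum.swap[of _ UNIV "{..i}"], subst sum.swap[of _ ?W "{..i}"]) (rule refl)
  also have "\<dots> = (\<Sum>j\<le>i. taylor_coeff (i - j) (\<lambda>s. diff_op m UNIV (A s) (\<Psi> j s) a z))"
    unfolding diff_op_def
  proof (intro sum.cong refl)
    fix j assume "j \<in> {..i}"
    then have sAP: "smooth (\<lambda>s. A s a b w z * partials w (\<Psi> j s b) z)" if "w \<in> ?W" for b w
      using i that by (intro smooth_mult sA sP) auto
    show "(\<Sum>b\<in>UNIV. \<Sum>w\<in>?W. taylor_coeff (i - j) (\<lambda>s. A s a b w z * partials w (\<Psi> j s b) z))
        = taylor_coeff (i - j) (\<lambda>s. \<Sum>b\<in>UNIV. \<Sum>w\<in>?W. A s a b w z * partials w (\<Psi> j s b) z)"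
      by (subst taylor_coeff_sum, intro smooth_sum sAP)
        (auto intro!: sum.cong taylor_coeff_sum[symmetric] sAP)
  qed
  finally show ?thesis .
qed

lemma block_hat_eq: "block_hat N U \<eta> = taylor_block (\<lambda>s. U (u_hat N \<eta> s))"
  unfolding block_hat_def taylor_block_def taylor_coeff_def ..

lemma partial_taylor_block:
  assumes "smooth (\<lambda>(s, z). A s (snd i) (snd j) w z :: 'k::euclidean_space)"
  shows "partial x (taylor_block A i j w) z = taylor_block (\<lambda>s a b w. partial x (A s a b w)) i j w z"
proof (cases "fst j \<le> fst i")
  case True
  then show ?thesis
    using frechet_derivative_taylor_coeff[OF assms]
    by (simp add: taylor_block_def partial_def case_prod_beta')
next
  case False
  then show ?thesis
    by (simp add: taylor_block_def partial_def case_prod_beta')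
qed

section \<open>Gateaux derivatives along families in the function space\<close>

context smooth_function_space
begin

lemma smooth_operatorD:
  assumes "smooth_operator P m U" "c \<in> P" "length w \<le> m"
  shows "smooth (\<lambda>(p, z). U (c p) i j w z)"
  using assms by (simp add: smooth_operator_def)

lemma family_first: "c \<in> P \<Longrightarrow> (\<lambda>p. c (fst p, 0)) \<in> P"
  by (rule reparametrize[where g="\<lambda>p. (fst p, 0)"]) (intro smooth_Pair smooth_fst smooth_const)

lemma zero_family: "(\<lambda>p a z. 0) \<in> P"
proof -
  obtain u where "u \<in> M" using nonempty by blast
  from scale[OF smooth_const[of 0] const_family[OF this]] show ?thesis by simp
qed

lemma sum_family: "finite L \<Longrightarrow> (\<And>l. l \<in> L \<Longrightarrow> c l \<in> P) \<Longrightarrow> (\<lambda>p a z. \<Sum>l\<in>L. c l p a z) \<in> P"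
  by (induction L rule: finite_induct) (auto simp: zero_family intro: add)

lemma polynomial_family:
  assumes "\<And>i. i \<le> N \<Longrightarrow> e i \<in> M"
  shows "(\<lambda>p a z. \<Sum>i\<le>N. fst p ^ i *\<^sub>R e i a z) \<in> P"
  by (intro sum_family scale[OF _ const_family] smooth_power smooth_fst) (auto intro: assms)

lemma u_hat_family: "\<eta> \<in> perturbation_space N M \<Longrightarrow> (\<lambda>p. u_hat N \<eta> (fst p)) \<in> P"
  unfolding u_hat_def perturbation_space_def
  by (intro polynomial_family[where e="\<lambda>i a. \<eta> (i, a)"]) simp

text \<open>The first parameter moves base point and direction; the second runs along the straight
  line of the Gateaux derivative.\<close>

lemma line_family: "c \<in> P \<Longrightarrow> S \<in> P \<Longrightarrow>
    (\<lambda>p a z. c (fst p, 0) a z + snd p *\<^sub>R S (fst p, 0) a z) \<in> P"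
  by (intro add scale family_first smooth_snd)

text \<open>Linearity is the chain rule for the plane \<open>(s, t) \<mapsto> u + s S + t S'\<close>, which belongs to \<open>P\<close>.\<close>

lemma gateaux_add_scale:
  assumes U: "smooth_operator P m U" and w: "length w \<le> m"
    and u: "u \<in> M" and S: "S \<in> M" and S': "S' \<in> M"
  shows "gateaux U u (\<lambda>a z. S a z + r *\<^sub>R S' a z) i j w z
           = gateaux U u S i j w z + r *\<^sub>R gateaux U u S' i j w z"
proof -
  define c where "c = (\<lambda>(p :: real \<times> real) a z. u a z + (fst p *\<^sub>R S a z + snd p *\<^sub>R S' a z))"
  have "c \<in> P"
    unfolding c_def
    by (intro add[OF const_family] add scale[OF _ const_family] u S S' smooth_fst smooth_snd)
  define F where "F = (\<lambda>p. U (c p) i j w z)"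
  have F: "smooth F"
    unfolding F_def using smooth_curry[OF smooth_operatorD[OF U \<open>c \<in> P\<close> w] smooth_id smooth_const] .
  have D: "vector_derivative (\<lambda>t. F (t *\<^sub>R v)) (at 0) = frechet_derivative F (at 0) v" for v
  proof -
    have "((\<lambda>t::real. t *\<^sub>R v) has_derivative (\<lambda>t. t *\<^sub>R v)) (at 0)"
      by (auto intro!: derivative_eq_intros)
    from has_derivative_compose[OF this smooth_has_derivative[OF F]]
    show ?thesis
      using linear_cmul[OF has_derivative_linear[OF smooth_has_derivative[OF F]]]
      by (intro vector_derivative_at) (simp add: has_vector_derivative_def)
  qed
  \<comment> \<open>In the plane \<open>c\<close> the vectors \<open>(1, 0)\<close>,
    \<open>(0, 1)\<close> and \<open>(1, r)\<close> stand for the directions \<open>S\<close>,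
    \<open>S'\<close> and \<open>S\<close> plus \<open>r\<close> times \<open>S'\<close>.\<close>
  have "(1, r) = (1, 0) + r *\<^sub>R (0, 1::real)" by simp
  then have "frechet_derivative F (at 0) (1, r)
      = frechet_derivative F (at 0) (1, 0) + r *\<^sub>R frechet_derivative F (at 0) (0, 1)"
    using linear_add[OF has_derivative_linear[OF smooth_has_derivative[OF F]]]
      linear_cmul[OF has_derivative_linear[OF smooth_has_derivative[OF F]]] by metis
  then show ?thesis
    unfolding D[symmetric]
    by (simp add: F_def c_def gateaux_def scaleR_add_right)
qed

text \<open>Along a family the Gateaux derivative is the derivative in \<open>t\<close> at 0 of a
  function that is smooth in \<open>s\<close>, \<open>t\<close> and \<open>z\<close> together; this
  makes it jointly smooth in \<open>s\<close> and \<open>z\<close>.\<close>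

lemma gateaux_line_family:
  fixes i j :: 'i
  assumes U: "smooth_operator P m U" and w: "length w \<le> m" and c: "c \<in> P" and S: "S \<in> P"
  defines "F \<equiv> \<lambda>p z. U (\<lambda>a z. c (fst p, 0) a z + snd p *\<^sub>R S (fst p, 0) a z) i j w z"
  shows "smooth (\<lambda>(p, z). F p z)"
    and "gateaux U (c (s, 0)) (S (s, 0)) i j w z = frechet_derivative (\<lambda>t. F (s, t) z) (at 0) 1"
    and "smooth (\<lambda>(s, z). gateaux U (c (s, 0)) (S (s, 0)) i j w z)"
proof -
  show F: "smooth (\<lambda>(p, z). F p z)"
    unfolding F_def by (rule smooth_operatorD[OF U line_family[OF c S] w])
  have st: "smooth (\<lambda>t. F (s, t) z)" for s z
    by (intro smooth_curry[OF F] smooth_Pair smooth_id smooth_const)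
  show eq: "gateaux U (c (s, 0)) (S (s, 0)) i j w z = frechet_derivative (\<lambda>t. F (s, t) z) (at 0) 1" for s z
    using smooth_differentiable[OF st[of s z]]
    by (simp add: F_def gateaux_def frechet_derivative_eq_vector_derivative)
  \<comment> \<open>Regrouping \<open>((s, t), z)\<close> as \<open>((s, z), t)\<close> makes
    \<open>t\<close> the variable in which the section lemma differentiates.\<close>
  have "smooth (\<lambda>(q, t). F (fst q, t) (snd q))"
    unfolding case_prod_beta'
    by (intro smooth_curry[OF F] smooth_Pair smooth_snd smooth_compose[OF smooth_fst smooth_fst]
        smooth_compose[OF smooth_snd smooth_fst])
  from smooth_curry[OF smooth_frechet_derivative_section[OF this] smooth_id smooth_const]
  show "smooth (\<lambda>(s, z). gateaux U (c (s, 0)) (S (s, 0)) i j w z)"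
    by (simp add: eq case_prod_beta')
qed

text \<open>Repeated use of \<open>division\<close>. It keeps the coefficients in \<open>M\<close>
  and the remainder in \<open>P\<close>, so that both are admissible directions for Gateaux
  derivatives.\<close>

lemma taylor_expansion:
  "c \<in> P \<Longrightarrow> \<exists>e r. (\<forall>i. e i \<in> M) \<and> r \<in> P \<and>
     (\<forall>s. c (s, 0) = (\<lambda>a z. (\<Sum>i<n. s ^ i *\<^sub>R e i a z) + s ^ n *\<^sub>R r (s, 0) a z))"
proof (induction n arbitrary: c)
  case 0
  then show ?case using nonempty by (auto intro!: exI[of _ c])
next
  case (Suc n)
  \<comment> \<open>Subtracting the value at 0 makes the family vanish for \<open>s = 0\<close>, as
    \<open>division\<close> demands.\<close>
  have "(\<lambda>p a z. c (fst p, 0) a z + (- 1) *\<^sub>R c (0, 0) a z) \<in> P"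
    by (rule add[OF family_first[OF Suc.prems] scale[OF smooth_const const_family[OF mem[OF Suc.prems]]]])
  from division[OF this] obtain d where d: "d \<in> P"
    and eq: "\<And>s t. (\<lambda>a z. c (s, 0) a z - c (0, 0) a z) = (\<lambda>a z. s *\<^sub>R d (s, t) a z)"
    by auto
  from Suc.IH[OF d] obtain e r where e: "\<And>i. e i \<in> M" and r: "r \<in> P"
    and d_eq: "\<And>s. d (s, 0) = (\<lambda>a z. (\<Sum>i<n. s ^ i *\<^sub>R e i a z) + s ^ n *\<^sub>R r (s, 0) a z)"
    by blast
  have c_eq: "c (s, 0) a z = c (0, 0) a z + s *\<^sub>R d (s, 0) a z" for s a z
    using fun_cong[OF fun_cong[OF eq[of s 0]], of a z] by (simp add: algebra_simps)
  \<comment> \<open>The value at 0 becomes the coefficient of index 0, and the coefficients of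
    \<open>d\<close> move up by one.\<close>
  have "c (s, 0) = (\<lambda>a z. (\<Sum>i<Suc n. s ^ i *\<^sub>R (case i of 0 \<Rightarrow> c (0, 0) | Suc i \<Rightarrow> e i) a z)
      + s ^ Suc n *\<^sub>R r (s, 0) a z)" for s
    unfolding sum.lessThan_Suc_shift
    by (intro ext) (simp add: c_eq[of s] d_eq scaleR_add_right scaleR_sum_right add.assoc)
  moreover have "(case i of 0 \<Rightarrow> c (0, 0) | Suc i \<Rightarrow> e i) \<in> M" for i
    using e mem[OF Suc.prems] by (simp split: nat.split)
  ultimately show ?case
    using r by (intro exI[of _ "\<lambda>i. case i of 0 \<Rightarrow> c (0, 0) | Suc i \<Rightarrow> e i"] exI[of _ r]) auto
qed

text \<open>The direction \<open>K_hat N K \<eta>\<close> moves \<open>u_hat N \<eta> s\<close>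
  along the Taylor polynomial in \<open>s\<close> of \<open>K (u_hat N \<eta> s)\<close>. The
  Gateaux derivatives along this polynomial and along \<open>K (u_hat N \<eta> s)\<close> itself
  differ by a term of order \<open>s ^ Suc N\<close>, which no block sees.\<close>

lemma gateaux_block_hat:
  assumes K: "smooth_vector_field P K" and U: "smooth_operator P m U"
    and \<eta>: "\<eta> \<in> perturbation_space N M" and i: "fst i \<le> N" and w: "length w \<le> m"
  shows "gateaux (block_hat N U) \<eta> (K_hat N K \<eta>) i j w z
           = taylor_block (\<lambda>s. gateaux U (u_hat N \<eta> s) (K (u_hat N \<eta> s))) i j w z"
proof (cases "fst j \<le> fst i")
  case False
  then show ?thesis
    by (simp add: block_hat_eq taylor_block_def gateaux_def case_prod_beta')
next
  case True
  let ?u = "\<lambda>s. u_hat N \<eta> s" and ?k = "fst i - fst j"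
  define c where "c = (\<lambda>p :: real \<times> real. u_hat N \<eta> (fst p))"
  have c: "c \<in> P"
    unfolding c_def using u_hat_family[OF \<eta>] .
  then have Kc: "(\<lambda>p. K (c p)) \<in> P"
    using K by (simp add: smooth_vector_field_def)
  \<comment> \<open>Order \<open>Suc N\<close> makes every coefficient up to index \<open>N\<close>
    explicit and leaves \<open>s ^ Suc N\<close> in front of the remainder.\<close>
  from taylor_expansion[OF this, of "Suc N"] obtain e r where e: "\<And>i. e i \<in> M" and r: "r \<in> P"
    and K_eq: "\<And>s. K (?u s) = (\<lambda>a z. (\<Sum>i<Suc N. s ^ i *\<^sub>R e i a z) + s ^ Suc N *\<^sub>R r (s, 0) a z)"
    unfolding c_def by auto
  define \<kappa> where "\<kappa> = (\<lambda>(p :: real \<times> real) a z. \<Sum>i\<le>N. fst p ^ i *\<^sub>R e i a z)"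
  have \<kappa>: "\<kappa> \<in> P"
    unfolding \<kappa>_def by (intro polynomial_family e)
  have smooth_r: "smooth (\<lambda>s. r (s, 0) a z)" for a z
    using smooth_curry[OF jointly_smooth[OF r] smooth_Pair[OF smooth_id smooth_const] smooth_const] .
  have K_hat: "K_hat N K \<eta> (l, a) z = e l a z" if "l \<le> N" for l a z
  proof -
    have "taylor_coeff l (\<lambda>s. (\<Sum>i<Suc N. s ^ i *\<^sub>R e i a z) + s ^ Suc N *\<^sub>R r (s, 0) a z)
        = taylor_coeff l (\<lambda>s. \<Sum>i<Suc N. s ^ i *\<^sub>R e i a z)
          + taylor_coeff l (\<lambda>s. s ^ Suc N *\<^sub>R r (s, 0) a z)"
      by (intro taylor_coeff_add smooth_sum smooth_scaleR smooth_power smooth_id smooth_const smooth_r)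
    also have "taylor_coeff l (\<lambda>s. s ^ Suc N *\<^sub>R r (s, 0) a z) = 0"
      using that by (intro taylor_coeff_eq_0 smooth_r) simp
    also have "taylor_coeff l (\<lambda>s. \<Sum>i<Suc N. s ^ i *\<^sub>R e i a z)
        = (\<Sum>i<Suc N. taylor_coeff l (\<lambda>s. s ^ i *\<^sub>R e i a z))"
      by (intro taylor_coeff_sum smooth_scaleR smooth_power smooth_id smooth_const)
    also have "\<dots> + 0 = e l a z"
      using that by (simp add: taylor_coeff_power del: sum.lessThan_Suc)
    finally have "taylor_coeff l (\<lambda>s. K (?u s) a z) = e l a z"
      unfolding K_eq .
    then show ?thesis
      by (simp add: K_hat_def taylor_coeff_def)
  qed
  \<comment> \<open>\<open>u_hat\<close> is linear in \<open>\<eta>\<close>, and the blocks of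
    \<open>K_hat N K \<eta>\<close> are the coefficients of the polynomial
    \<open>\<kappa>\<close>.\<close>
  have u_hat: "u_hat N (\<lambda>a y. \<eta> a y + t *\<^sub>R K_hat N K \<eta> a y) s
      = (\<lambda>a z. c (s, 0) a z + t *\<^sub>R \<kappa> (s, 0) a z)" for s t
    by (simp add: u_hat_def c_def \<kappa>_def K_hat scaleR_add_right sum.distrib scaleR_sum_right
        mult.commute)
  let ?F = "\<lambda>s t. U (\<lambda>a z. c (s, 0) a z + t *\<^sub>R \<kappa> (s, 0) a z) (snd i) (snd j) w z"
  note line = gateaux_line_family[OF U w c]
  have F: "smooth (\<lambda>(s, t). ?F s t)"
    using smooth_curry[OF line(1)[OF \<kappa>] smooth_id smooth_const] by (simp add: case_prod_beta')
  have "gateaux (block_hat N U) \<eta> (K_hat N K \<eta>) i j w z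
      = vector_derivative (\<lambda>t. taylor_coeff ?k (\<lambda>s. ?F s t)) (at 0)"
    using True by (simp add: gateaux_def block_hat_eq taylor_block_def case_prod_beta' u_hat)
  also have "\<dots> = frechet_derivative (\<lambda>t. taylor_coeff ?k (\<lambda>s. ?F s t)) (at 0) 1"
    using smooth_differentiable[OF smooth_taylor_coeff[OF F]]
    by (simp add: frechet_derivative_eq_vector_derivative)
  \<comment> \<open>The direction parameter \<open>t\<close> takes the role of the variable
    \<open>z\<close> in the interchange lemma.\<close>
  also have "\<dots> = taylor_coeff ?k (\<lambda>s. gateaux U (?u s) (\<kappa> (s, 0)) (snd i) (snd j) w z)"
    using frechet_derivative_taylor_coeff[OF F] line(2)[OF \<kappa>] by (simp add: c_def)
  \<comment> \<open>The added term carries the factor \<open>s ^ Suc N\<close>, while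
    \<open>?k \<le> N\<close>.\<close>
  also have "\<dots> = taylor_coeff ?k (\<lambda>s. gateaux U (?u s) (\<kappa> (s, 0)) (snd i) (snd j) w z
      + s ^ Suc N *\<^sub>R gateaux U (?u s) (r (s, 0)) (snd i) (snd j) w z)"
  proof -
    have "smooth (\<lambda>s. gateaux U (?u s) (S (s, 0)) (snd i) (snd j) w z)" if "S \<in> P" for S
      using smooth_curry[OF line(3)[OF that] smooth_id smooth_const] by (simp add: c_def)
    with i \<kappa> r show ?thesis
      by (subst taylor_coeff_add)
        (auto intro!: smooth_scaleR smooth_power smooth_id simp: taylor_coeff_eq_0 simp del: power_Suc)
  qed
  \<comment> \<open>Linearity in the direction merges polynomial and remainder into
    \<open>K (?u s)\<close>.\<close>
  also have "(\<lambda>s. gateaux U (?u s) (\<kappa> (s, 0)) (snd i) (snd j) w z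
      + s ^ Suc N *\<^sub>R gateaux U (?u s) (r (s, 0)) (snd i) (snd j) w z)
      = (\<lambda>s. gateaux U (?u s) (K (?u s)) (snd i) (snd j) w z)"
    using mem[OF c, of "(_, 0)"] mem[OF \<kappa>, of "(_, 0)"] mem[OF r]
    unfolding K_eq lessThan_Suc_atMost
    by (subst gateaux_add_scale[OF U w, symmetric]) (simp_all add: c_def \<kappa>_def)
  finally show ?thesis
    using True by (simp add: taylor_block_def case_prod_beta')
qed

end

section \<open>Verification of the perturbed identity row by row\<close>

theorem theorem3p4:
  fixes M :: "('q::finite \<Rightarrow> real^'d \<Rightarrow> 'k::{real_normed_field,euclidean_space}) set"
    and P :: "(real \<times> real \<Rightarrow> 'q \<Rightarrow> real^'d \<Rightarrow> 'k) set"
    and K :: "('q \<Rightarrow> real^'d \<Rightarrow> 'k) \<Rightarrow> ('q \<Rightarrow> real^'d \<Rightarrow> 'k)"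
    and U V :: "('q \<Rightarrow> real^'d \<Rightarrow> 'k) \<Rightarrow> 'r::finite \<Rightarrow> 'r \<Rightarrow> 'd list \<Rightarrow> real^'d \<Rightarrow> 'k"
    and x :: 'd
    and N m n :: nat
  assumes "1 \<le> N"
    and "smooth_function_space M P"
    and "smooth_vector_field P K"
    and "smooth_operator P m U"
    and "smooth_operator P n V"
    and "zero_curvature_representation x M K UNIV m U n V"
  shows "zero_curvature_representation x (perturbation_space N M) (K_hat N K) ({..N} \<times> UNIV)
           m (block_hat N U) n (block_hat N V)"
proof -
  interpret smooth_function_space M P by (rule assms)
  note K = assms(3) and U = assms(4) and V = assms(5) and zcr = assms(6)
  show ?thesis
    unfolding zero_curvature_representation_def
  proof (intro ballI allI impI)
    fix \<eta> and \<phi> :: "nat \<times> 'r \<Rightarrow> real^'d \<Rightarrow> 'k" and l z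
    assume \<eta>: "\<eta> \<in> perturbation_space N M"
      and \<phi>: "\<forall>l\<in>{..N} \<times> (UNIV :: 'r set). smooth (\<phi> l)"
      and l: "l \<in> {..N} \<times> (UNIV :: 'r set)"
    obtain i a where ia: "l = (i, a)" by force
    then have i: "i \<le> N" using l by simp
    let ?I = "{..N} \<times> (UNIV :: 'r set)"
    \<comment> \<open>\<open>?\<Phi> j\<close> is block \<open>j\<close> of the test vector
      \<open>\<phi>\<close>, viewed as a curve that is constant in \<open>s\<close>.\<close>
    let ?u = "u_hat N \<eta>" and ?\<Phi> = "\<lambda>j (s::real) b. \<phi> (j, b)"
    let ?U = "\<lambda>s. U (?u s)" and ?V = "\<lambda>s. V (?u s)"
    let ?U' = "\<lambda>s. gateaux U (?u s) (K (?u s))" and ?V' = "\<lambda>s a b w. partial x (?V s a b w)"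
    note u = u_hat_family[OF \<eta>]
    have Ku: "(\<lambda>p. K (?u (fst p))) \<in> P"
      using K u by (simp add: smooth_vector_field_def)
    have coeff: "smooth (\<lambda>(s, z). W (?u s) a b w z)"
      if "smooth_operator P k W" "length w \<le> k" for W k and a b :: 'r and w
    proof -
      have "smooth (\<lambda>y. W (?u (fst (fst y, 0 :: real))) a b w (snd y))"
        by (rule smooth_curry[OF smooth_operatorD[OF that(1) u that(2)]])
          (intro smooth_Pair smooth_fst smooth_snd smooth_const)+
      then show ?thesis by (simp add: case_prod_beta')
    qed
    have sU: "smooth (\<lambda>(s, z). ?U s a b w z)" if "length w \<le> m" for a b w
      using coeff[OF U that] .
    have sV: "smooth (\<lambda>(s, z). ?V s a b w z)" if "length w \<le> n" for a b w
      using coeff[OF V that] .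
    have sU': "smooth (\<lambda>(s, z). ?U' s a b w z)" if "length w \<le> m" for a b w
      using gateaux_line_family(3)[OF U that u Ku] by simp
    have sV': "smooth (\<lambda>(s, z). ?V' s a b w z)" if "length w \<le> n" for a b w
      using smooth_frechet_derivative_section[OF sV[OF that]] by (simp add: partial_def)
    have s\<Phi>: "smooth (\<lambda>(s, z). ?\<Phi> j s b z)" if "j \<le> N" for j b
      unfolding case_prod_beta'
      using \<phi> that by (intro smooth_compose[OF _ smooth_snd]) auto
    \<comment> \<open>A constant curve has only the coefficient of index 0, so the sum reduces to
      \<open>j = l\<close>; this puts \<open>\<phi>\<close> into the shape required by
      \<open>diff_op_taylor_block\<close>.\<close>
    have \<phi>_eq: "\<phi> (l, b) z = (\<Sum>j\<le>l. taylor_coeff (l - j) (\<lambda>s. ?\<Phi> j s b z))" for l b z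
    proof -
      have "(\<Sum>j\<le>l. taylor_coeff (l - j) (\<lambda>s. ?\<Phi> j s b z)) = (\<Sum>j\<le>l. if j = l then \<phi> (j, b) z else 0)"
        by (intro sum.cong) (auto simp: taylor_coeff_const)
      then show ?thesis by simp
    qed
    have sec: "smooth (\<lambda>(s, z). diff_op k UNIV (A s) (\<Psi> s) b z)"
      if "\<And>a b w. length w \<le> k \<Longrightarrow> smooth (\<lambda>(s, z). A s a b w z)"
        and "\<And>b. smooth (\<lambda>(s, z). \<Psi> s b z)"
      for k b and A :: "real \<Rightarrow> 'r \<Rightarrow> 'r \<Rightarrow> 'd list \<Rightarrow> real^'d \<Rightarrow> 'k" and \<Psi>
      using that by (intro smooth_diff_op_section) auto
    have sV\<Phi>: "smooth (\<lambda>(s, z). diff_op n UNIV (?V s) (?\<Phi> j s) b z)" if "j \<le> N" for j b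
      by (intro sec sV s\<Phi> that)
    have sU\<Phi>: "smooth (\<lambda>(s, z). diff_op m UNIV (?U s) (?\<Phi> j s) b z)" if "j \<le> N" for j b
      by (intro sec sU s\<Phi> that)
    have V\<phi>: "diff_op n ?I (block_hat N V \<eta>) \<phi> (i, a) z
        = (\<Sum>j\<le>i. taylor_coeff (i - j) (\<lambda>s. diff_op n UNIV (?V s) (?\<Phi> j s) a z))"
      if "i \<le> N" for i a z
      unfolding block_hat_eq by (rule diff_op_taylor_block[OF sV s\<Phi> \<phi>_eq that])
    have U\<phi>: "diff_op m ?I (block_hat N U \<eta>) \<phi> (i, a) z
        = (\<Sum>j\<le>i. taylor_coeff (i - j) (\<lambda>s. diff_op m UNIV (?U s) (?\<Phi> j s) a z))"
      if "i \<le> N" for i a z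
      unfolding block_hat_eq by (rule diff_op_taylor_block[OF sU s\<Phi> \<phi>_eq that])
    have 1: "diff_op m ?I (gateaux (block_hat N U) \<eta> (K_hat N K \<eta>)) \<phi> (i, a) z
        = (\<Sum>j\<le>i. taylor_coeff (i - j) (\<lambda>s. diff_op m UNIV (?U' s) (?\<Phi> j s) a z))"
    proof -
      have "diff_op m ?I (gateaux (block_hat N U) \<eta> (K_hat N K \<eta>)) \<phi> (i, a) z
          = diff_op m ?I (taylor_block ?U') \<phi> (i, a) z"
        by (intro diff_op_cong gateaux_block_hat[OF K U \<eta>]) (simp_all add: i)
      also note diff_op_taylor_block[where \<Psi>="?\<Phi>" and A="?U'", OF sU' s\<Phi> \<phi>_eq i]
      finally show ?thesis .
    qed
    have 2: "diff_op n ?I (\<lambda>i j w. partial x (block_hat N V \<eta> i j w)) \<phi> (i, a) z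
        = (\<Sum>j\<le>i. taylor_coeff (i - j) (\<lambda>s. diff_op n UNIV (?V' s) (?\<Phi> j s) a z))"
    proof -
      have "diff_op n ?I (\<lambda>i j w. partial x (block_hat N V \<eta> i j w)) \<phi> (i, a) z
          = diff_op n ?I (taylor_block ?V') \<phi> (i, a) z"
        unfolding block_hat_eq by (intro diff_op_cong partial_taylor_block sV)
      also note diff_op_taylor_block[where \<Psi>="?\<Phi>" and A="?V'", OF sV' s\<Phi> \<phi>_eq i]
      finally show ?thesis .
    qed
    \<comment> \<open>By \<open>V\<phi>\<close> the inner result again has the shape of an
      admissible input, now with curves that depend on \<open>s\<close>, so the block lemma applies
      a second time.\<close>
    have 3: "diff_op m ?I (block_hat N U \<eta>) (diff_op n ?I (block_hat N V \<eta>) \<phi>) (i, a) z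
        = (\<Sum>j\<le>i. taylor_coeff (i - j)
            (\<lambda>s. diff_op m UNIV (?U s) (diff_op n UNIV (?V s) (?\<Phi> j s)) a z))"
      unfolding block_hat_eq[of N U] by (rule diff_op_taylor_block[OF sU sV\<Phi> V\<phi> i])
    have 4: "diff_op n ?I (block_hat N V \<eta>) (diff_op m ?I (block_hat N U \<eta>) \<phi>) (i, a) z
        = (\<Sum>j\<le>i. taylor_coeff (i - j)
            (\<lambda>s. diff_op n UNIV (?V s) (diff_op m UNIV (?U s) (?\<Phi> j s)) a z))"
      unfolding block_hat_eq[of N V] by (rule diff_op_taylor_block[OF sV sU\<Phi> U\<phi> i])
    \<comment> \<open>The original identity at \<open>?u s\<close>, tested on block \<open>j\<close>
      of \<open>\<phi>\<close>, holds for every \<open>s\<close>; a function vanishing identically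
      in \<open>s\<close> has zero Taylor coefficients, and smoothness of the four terms allows
      splitting them.\<close>
    have zero: "taylor_coeff k (\<lambda>s. diff_op m UNIV (?U' s) (?\<Phi> j s) a z)
        - taylor_coeff k (\<lambda>s. diff_op n UNIV (?V' s) (?\<Phi> j s) a z)
        + (taylor_coeff k (\<lambda>s. diff_op m UNIV (?U s) (diff_op n UNIV (?V s) (?\<Phi> j s)) a z)
           - taylor_coeff k (\<lambda>s. diff_op n UNIV (?V s) (diff_op m UNIV (?U s) (?\<Phi> j s)) a z)) = 0"
      if j: "j \<le> N" for j k
    proof -
      have at_z: "smooth (\<lambda>s. f s z)" if "smooth (\<lambda>(s, z). f s z)" for f :: "real \<Rightarrow> real^'d \<Rightarrow> 'k"
        using smooth_curry[OF that smooth_id smooth_const] .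
      have "?u s \<in> M" for s
        using mem[OF u, of "(s, 0)"] by simp
      then have "(\<lambda>s. diff_op m UNIV (?U' s) (?\<Phi> j s) a z - diff_op n UNIV (?V' s) (?\<Phi> j s) a z
          + (diff_op m UNIV (?U s) (diff_op n UNIV (?V s) (?\<Phi> j s)) a z
             - diff_op n UNIV (?V s) (diff_op m UNIV (?U s) (?\<Phi> j s)) a z)) = (\<lambda>s. 0)"
        using zcr \<phi> j unfolding zero_curvature_representation_def by simp
      moreover have "smooth (\<lambda>s. diff_op m UNIV (?U' s) (?\<Phi> j s) a z)"
        "smooth (\<lambda>s. diff_op n UNIV (?V' s) (?\<Phi> j s) a z)"
        "smooth (\<lambda>s. diff_op m UNIV (?U s) (diff_op n UNIV (?V s) (?\<Phi> j s)) a z)"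
        "smooth (\<lambda>s. diff_op n UNIV (?V s) (diff_op m UNIV (?U s) (?\<Phi> j s)) a z)"
        by (intro at_z sec sU sV sU' sV' s\<Phi> sU\<Phi> sV\<Phi> j; assumption)+
      ultimately show ?thesis
        using taylor_coeff_const[of k "0 :: 'k"]
        by (simp add: taylor_coeff_add[symmetric] taylor_coeff_diff[symmetric] smooth_diff)
    qed
    \<comment> \<open>All four terms are sums over the same \<open>j \<le> i\<close> with
      coefficient index \<open>i - j\<close>, so the row vanishes summand by summand.\<close>
    show "diff_op m ?I (gateaux (block_hat N U) \<eta> (K_hat N K \<eta>)) \<phi> l z
        - diff_op n ?I (\<lambda>i j w. partial x (block_hat N V \<eta> i j w)) \<phi> l z
        + (diff_op m ?I (block_hat N U \<eta>) (diff_op n ?I (block_hat N V \<eta>) \<phi>) l z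
           - diff_op n ?I (block_hat N V \<eta>) (diff_op m ?I (block_hat N U \<eta>) \<phi>) l z) = 0"
      unfolding ia 1 2 3 4 sum_subtractf[symmetric] sum.distrib[symmetric]
      using i by (intro sum.neutral ballI zero) simp
  qed
qed

end
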